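(* Let $S$ be a join-semilattice with the minimal join-cover refinement property (MCRP) and with no infinite $D$-sequence of join-irreducible elements. Then the ideal lattice $\operatorname{Id}S$ is fermentable; thus $\operatorname{Id}S$ has a lattice embedding into a direct product of finite lower bounded lattices.
   Context: Let $S$ be a join-semilattice. An ideal of $S$ is a lower subset closed under finite joins; if $S$ has a zero element, ideals contain it, and if $S$ has no zero element, the empty set is counted as an ideal. $\operatorname{Id}S$ is the set of ideals of $S$ ordered by inclusion. Put $S^-=S\setminus\{0\}$ if $S$ has a zero (least) element, and $S^-=S$ otherwise. $\mathrm{J}(S)$ is the set of join-irreducible elements of $S$, i.e. elements of $S^-$ that are not the join of two strictly smaller elements. For $X\subseteq S$, $\downarrow X=\{y\in S\mid \exists x\in X,\ y\leq x\}$; $X$ refines $Y$, written $X\ll Y$, if $X\subseteq\downarrow Y$. For $a\in S^-$: - $\mathcal{C}(a)$ is the set of all finite $X\subseteq S$ with $a\notin\downarrow X$ and $a\leq\bigvee X$ (the nontrivial join-covers of $a$; they are necessarily nonempty); - $\mathcal{M}(a)$ is the set of all $E\in\mathcal{C}(a)$ such that for every $X\in\mathcal{C}(a)$, $X\ll E$ implies $E\subseteq X$; - for $\Sigma\subseteq S$, $\mathcal{M}_\Sigma(a)=\{E\in\mathcal{M}(a)\mid E\subseteq\Sigma\}$. For $\Sigma\subseteq S$, $S$ has the $\Sigma$-MCRP if for every $p\in\Sigma\cap S^-$, every element of $\mathcal{C}(p)$ is refined by some element of $\mathcal{M}_\Sigma(p)$, and $\mathcal{M}_\Sigma(p)$ is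 finite. $S$ has the MCRP if it has the $S$-MCRP. The join-dependency relation $D$ on $\mathrm{J}(S)$: $a\mathbin{D}b$ iff $a\neq b$ and there is $c\in S$ such that $a\leq b\vee c$ but $a\nleq x\vee c$ for all $x<b$. An infinite $D$-sequence is a sequence $(a_n)_{n<\omega}$ in $\mathrm{J}(S)$ with $a_n\mathbin{D}a_{n+1}$ for all $n$. A subset $\Sigma\subseteq\mathrm{J}(S)$ is a leaven of $S$ if: (1) $\Sigma$ join-generates $S$, i.e. every element of $S$ is a (possibly infinite or empty) join of elements of $\Sigma$; (2) $S$ satisfies the $\Sigma$-MCRP; (3) there is no infinite $D$-sequence of elements of $\Sigma$. $S$ is fermentable if it has a leaven. A lattice homomorphism $f\colon K\to L$ is lower bounded if the preimage under $f$ of any principal filter of $L$ is either empty or has a least element. A lattice $L$ is lower bounded if every lattice homomorphism from a finitely generated free lattice to $L$ is lower bounded. *)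

theory Defs
  imports "HOL-Algebra.Lattice"
begin

section \<open>Join-semilattices and their ideals\<close>

text \<open>
  Join-semilattices are the \<^locale>\<open>upper_semilattice\<close>s of HOL-Algebra: carrier-based partial
  orders (equality being HOL equality) in which any two elements have a least upper bound.
  A zero element is not assumed.
\<close>

definition is_zero :: "('a, 'm) gorder_scheme \<Rightarrow> 'a \<Rightarrow> bool" where
  "is_zero S z \<longleftrightarrow> least S z (carrier S)"

definition nonzero :: "('a, 'm) gorder_scheme \<Rightarrow> 'a set" where
  "nonzero S = {a \<in> carrier S. \<not> is_zero S a}"

definition down :: "('a, 'm) gorder_scheme \<Rightarrow> 'a set \<Rightarrow> 'a set" where
  "down S X = {y \<in> carrier S. \<exists>x\<in>X. y \<sqsubseteq>\<^bsub>S\<^esub> x}"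

definition refines :: "('a, 'm) gorder_scheme \<Rightarrow> 'a set \<Rightarrow> 'a set \<Rightarrow> bool" where
  "refines S X Y \<longleftrightarrow> X \<subseteq> down S Y"

text \<open>
  Closure under finite joins includes the empty join, whenever it exists.  Hence an ideal contains
  the zero element if there is one, and the empty set is an ideal exactly when there is none
  (see \<open>sl_ideal_zero\<close> and \<open>sl_ideal_empty_iff\<close> below).
\<close>

definition sl_ideal :: "('a, 'm) gorder_scheme \<Rightarrow> 'a set \<Rightarrow> bool" where
  "sl_ideal S I \<longleftrightarrow>
     I \<subseteq> carrier S \<and>
     down S I \<subseteq> I \<and>
     (\<forall>X u. finite X \<longrightarrow> X \<subseteq> I \<longrightarrow> is_lub S u X \<longrightarrow> u \<in> I)"

definition ideal_lattice :: "('a, 'm) gorder_scheme \<Rightarrow> 'a set gorder" where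
  "ideal_lattice S = \<lparr>carrier = {I. sl_ideal S I}, eq = (=), le = (\<subseteq>)\<rparr>"

lemma is_lub_empty_iff: "is_lub S z {} \<longleftrightarrow> is_zero S z"
  by (simp add: is_zero_def Upper_def)

lemma sl_ideal_zero: "sl_ideal S I \<Longrightarrow> is_zero S z \<Longrightarrow> z \<in> I"
  unfolding sl_ideal_def is_lub_empty_iff[symmetric] by blast

lemma sl_ideal_empty_iff: "sl_ideal S {} \<longleftrightarrow> \<not> (\<exists>z. is_zero S z)"
  by (auto simp: sl_ideal_def is_zero_def down_def Upper_def)


section \<open>Join-covers, the MCRP and fermentability\<close>

definition join_irreducibles :: "('a, 'm) gorder_scheme \<Rightarrow> 'a set" where
  "join_irreducibles S =
     {a \<in> nonzero S.
        \<not> (\<exists>x\<in>carrier S. \<exists>y\<in>carrier S. x \<sqsubset>\<^bsub>S\<^esub> a \<and> y \<sqsubset>\<^bsub>S\<^esub> a \<and> a = x \<squnion>\<^bsub>S\<^esub> y)}"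

text \<open>
  The join of the cover is required to exist; this only matters for the empty set, which is
  therefore never a join-cover of an element of \<^term>\<open>nonzero S\<close>.
\<close>

definition join_covers :: "('a, 'm) gorder_scheme \<Rightarrow> 'a \<Rightarrow> 'a set set" where
  "join_covers S a =
     {X. finite X \<and> X \<subseteq> carrier S \<and> a \<notin> down S X \<and> (\<exists>u. is_lub S u X \<and> a \<sqsubseteq>\<^bsub>S\<^esub> u)}"

definition minimal_join_covers :: "('a, 'm) gorder_scheme \<Rightarrow> 'a \<Rightarrow> 'a set set" where
  "minimal_join_covers S a =
     {E \<in> join_covers S a. \<forall>X \<in> join_covers S a. refines S X E \<longrightarrow> E \<subseteq> X}"

definition minimal_join_covers_in ::
    "('a, 'm) gorder_scheme \<Rightarrow> 'a set \<Rightarrow> 'a \<Rightarrow> 'a set set" where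
  "minimal_join_covers_in S \<Sigma> a = {E \<in> minimal_join_covers S a. E \<subseteq> \<Sigma>}"

definition MCRP_on :: "('a, 'm) gorder_scheme \<Rightarrow> 'a set \<Rightarrow> bool" where
  "MCRP_on S \<Sigma> \<longleftrightarrow>
     (\<forall>p \<in> \<Sigma> \<inter> nonzero S.
        (\<forall>X \<in> join_covers S p. \<exists>E \<in> minimal_join_covers_in S \<Sigma> p. refines S E X) \<and>
        finite (minimal_join_covers_in S \<Sigma> p))"

definition MCRP :: "('a, 'm) gorder_scheme \<Rightarrow> bool" where
  "MCRP S \<longleftrightarrow> MCRP_on S (carrier S)"

definition join_dep :: "('a, 'm) gorder_scheme \<Rightarrow> 'a \<Rightarrow> 'a \<Rightarrow> bool" where
  "join_dep S a b \<longleftrightarrow>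
     a \<in> join_irreducibles S \<and> b \<in> join_irreducibles S \<and> a \<noteq> b \<and>
     (\<exists>c \<in> carrier S. a \<sqsubseteq>\<^bsub>S\<^esub> b \<squnion>\<^bsub>S\<^esub> c \<and>
        (\<forall>x \<in> carrier S. x \<sqsubset>\<^bsub>S\<^esub> b \<longrightarrow> \<not> a \<sqsubseteq>\<^bsub>S\<^esub> x \<squnion>\<^bsub>S\<^esub> c))"

definition infinite_D_sequence :: "('a, 'm) gorder_scheme \<Rightarrow> (nat \<Rightarrow> 'a) \<Rightarrow> bool" where
  "infinite_D_sequence S a \<longleftrightarrow>
     (\<forall>n. a n \<in> join_irreducibles S \<and> join_dep S (a n) (a (Suc n)))"

definition join_generates :: "('a, 'm) gorder_scheme \<Rightarrow> 'a set \<Rightarrow> bool" where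
  "join_generates S \<Sigma> \<longleftrightarrow> (\<forall>a \<in> carrier S. \<exists>X \<subseteq> \<Sigma>. is_lub S a X)"

definition leaven :: "('a, 'm) gorder_scheme \<Rightarrow> 'a set \<Rightarrow> bool" where
  "leaven S \<Sigma> \<longleftrightarrow>
     \<Sigma> \<subseteq> join_irreducibles S \<and>
     join_generates S \<Sigma> \<and>
     MCRP_on S \<Sigma> \<and>
     \<not> (\<exists>a. infinite_D_sequence S a \<and> range a \<subseteq> \<Sigma>)"

definition fermentable :: "('a, 'm) gorder_scheme \<Rightarrow> bool" where
  "fermentable S \<longleftrightarrow> (\<exists>\<Sigma>. leaven S \<Sigma>)"


section \<open>Lattice homomorphisms, embeddings and direct products\<close>

definition lattice_hom ::
    "('a, 'm) gorder_scheme \<Rightarrow> ('b, 'n) gorder_scheme \<Rightarrow> ('a \<Rightarrow> 'b) \<Rightarrow> bool" where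
  "lattice_hom K L f \<longleftrightarrow> f \<in> carrier K \<rightarrow> carrier L \<and> join_pres K L f \<and> meet_pres K L f"

definition lattice_embedding ::
    "('a, 'm) gorder_scheme \<Rightarrow> ('b, 'n) gorder_scheme \<Rightarrow> ('a \<Rightarrow> 'b) \<Rightarrow> bool" where
  "lattice_embedding K L f \<longleftrightarrow> lattice_hom K L f \<and> inj_on f (carrier K)"

definition direct_product :: "'i set \<Rightarrow> ('i \<Rightarrow> ('b, 'n) gorder_scheme) \<Rightarrow> ('i \<Rightarrow> 'b) gorder" where
  "direct_product I L =
     \<lparr>carrier = (\<Pi>\<^sub>E i\<in>I. carrier (L i)), eq = (=), le = (\<lambda>f g. \<forall>i\<in>I. f i \<sqsubseteq>\<^bsub>L i\<^esub> g i)\<rparr>"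


section \<open>Free lattices\<close>

text \<open>
  The free lattice on \<open>X\<close> consists of the lattice terms with variables in \<open>X\<close>, modulo the
  congruence generated by the lattice identities.
\<close>

datatype (lvars: 'x) lterm =
    LVar 'x
  | LJoin "'x lterm" "'x lterm"
  | LMeet "'x lterm" "'x lterm"

inductive lat_eq :: "'x lterm \<Rightarrow> 'x lterm \<Rightarrow> bool" where
  lat_eq_refl: "lat_eq s s"
| lat_eq_sym: "lat_eq s t \<Longrightarrow> lat_eq t s"
| lat_eq_trans: "lat_eq s t \<Longrightarrow> lat_eq t u \<Longrightarrow> lat_eq s u"
| lat_eq_cong_join: "lat_eq s s' \<Longrightarrow> lat_eq t t' \<Longrightarrow> lat_eq (LJoin s t) (LJoin s' t')"
| lat_eq_cong_meet: "lat_eq s s' \<Longrightarrow> lat_eq t t' \<Longrightarrow> lat_eq (LMeet s t) (LMeet s' t')"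
| lat_eq_join_comm: "lat_eq (LJoin s t) (LJoin t s)"
| lat_eq_meet_comm: "lat_eq (LMeet s t) (LMeet t s)"
| lat_eq_join_assoc: "lat_eq (LJoin (LJoin s t) u) (LJoin s (LJoin t u))"
| lat_eq_meet_assoc: "lat_eq (LMeet (LMeet s t) u) (LMeet s (LMeet t u))"
| lat_eq_join_absorb: "lat_eq (LJoin s (LMeet s t)) s"
| lat_eq_meet_absorb: "lat_eq (LMeet s (LJoin s t)) s"

definition lterms :: "'x set \<Rightarrow> 'x lterm set" where
  "lterms X = {t. lvars t \<subseteq> X}"

definition lat_rel :: "'x set \<Rightarrow> ('x lterm \<times> 'x lterm) set" where
  "lat_rel X = {(s, t). s \<in> lterms X \<and> t \<in> lterms X \<and> lat_eq s t}"

definition free_lattice :: "'x set \<Rightarrow> 'x lterm set gorder" where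
  "free_lattice X =
     \<lparr>carrier = lterms X // lat_rel X, eq = (=),
      le = (\<lambda>A B. \<exists>s\<in>A. \<exists>t\<in>B. lat_eq (LJoin s t) t)\<rparr>"


section \<open>Lower bounded homomorphisms and lattices\<close>

definition lower_bounded_hom ::
    "('a, 'm) gorder_scheme \<Rightarrow> ('b, 'n) gorder_scheme \<Rightarrow> ('a \<Rightarrow> 'b) \<Rightarrow> bool" where
  "lower_bounded_hom K L f \<longleftrightarrow>
     lattice_hom K L f \<and>
     (\<forall>b \<in> carrier L. let P = {x \<in> carrier K. b \<sqsubseteq>\<^bsub>L\<^esub> f x} in P = {} \<or> (\<exists>m. least K m P))"

text \<open>
  Every finitely generated free lattice is isomorphic to \<^term>\<open>free_lattice X\<close> for some finite set
  \<open>X\<close> of natural numbers.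
\<close>

definition lower_bounded_lattice :: "('a, 'm) gorder_scheme \<Rightarrow> bool" where
  "lower_bounded_lattice L \<longleftrightarrow>
     lattice L \<and>
     (\<forall>(X :: nat set) f. finite X \<longrightarrow> lattice_hom (free_lattice X) L f \<longrightarrow>
        lower_bounded_hom (free_lattice X) L f)"


section \<open>The universal property of free lattices\<close>

definition lclass :: "'x set \<Rightarrow> 'x lterm \<Rightarrow> 'x lterm set" where
  "lclass X t = lat_rel X `` {t}"

lemma lterms_simps [simp]:
  "LVar x \<in> lterms X \<longleftrightarrow> x \<in> X"
  "LJoin s t \<in> lterms X \<longleftrightarrow> s \<in> lterms X \<and> t \<in> lterms X"
  "LMeet s t \<in> lterms X \<longleftrightarrow> s \<in> lterms X \<and> t \<in> lterms X"
  by (auto simp: lterms_def)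

lemma equiv_lat_rel: "equiv (lterms X) (lat_rel X)"
proof (rule equivI)
  show "lat_rel X \<subseteq> lterms X \<times> lterms X" by (auto simp: lat_rel_def)
  show "refl_on (lterms X) (lat_rel X)" by (auto simp: lat_rel_def refl_on_def intro: lat_eq_refl)
  show "sym (lat_rel X)" by (rule symI) (simp add: lat_rel_def lat_eq_sym)
  show "trans (lat_rel X)" by (rule transI) (use lat_eq_trans in \<open>fastforce simp: lat_rel_def\<close>)
qed

lemmas lat_eq_join_left = lat_eq_cong_join[OF _ lat_eq_refl]
lemmas lat_eq_join_right = lat_eq_cong_join[OF lat_eq_refl]
lemmas lat_eq_meet_left = lat_eq_cong_meet[OF _ lat_eq_refl]
lemmas lat_eq_meet_right = lat_eq_cong_meet[OF lat_eq_refl]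

declare lat_eq_trans [trans]

lemma lat_eq_join_idem: "lat_eq (LJoin s s) s"
proof -
  have "lat_eq (LJoin s s) (LJoin s (LMeet s (LJoin s s)))"
    by (rule lat_eq_join_right, rule lat_eq_sym, rule lat_eq_meet_absorb)
  also have "lat_eq \<dots> s" by (rule lat_eq_join_absorb)
  finally show ?thesis .
qed

lemma lat_eq_meet_iff_join: "lat_eq (LMeet s t) s \<longleftrightarrow> lat_eq (LJoin s t) t"
proof
  assume a: "lat_eq (LMeet s t) s"
  have "lat_eq (LJoin s t) (LJoin (LMeet s t) t)"
    by (rule lat_eq_join_left, rule lat_eq_sym, rule a)
  also have "lat_eq \<dots> (LJoin t (LMeet s t))" by (rule lat_eq_join_comm)
  also have "lat_eq \<dots> (LJoin t (LMeet t s))" by (rule lat_eq_join_right, rule lat_eq_meet_comm)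
  also have "lat_eq \<dots> t" by (rule lat_eq_join_absorb)
  finally show "lat_eq (LJoin s t) t" .
next
  assume a: "lat_eq (LJoin s t) t"
  have "lat_eq (LMeet s t) (LMeet s (LJoin s t))"
    by (rule lat_eq_meet_right, rule lat_eq_sym, rule a)
  also have "lat_eq \<dots> s" by (rule lat_eq_meet_absorb)
  finally show "lat_eq (LMeet s t) s" .
qed

lemma lat_eq_antisym:
  assumes "lat_eq (LJoin s t) t" "lat_eq (LJoin t s) s"
  shows "lat_eq s t"
proof -
  have "lat_eq s (LJoin t s)" by (rule lat_eq_sym, rule assms)
  also have "lat_eq \<dots> (LJoin s t)" by (rule lat_eq_join_comm)
  also have "lat_eq \<dots> t" by (rule assms)
  finally show ?thesis .
qed

lemma lat_eq_le_trans:
  assumes "lat_eq (LJoin s t) t" "lat_eq (LJoin t u) u"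
  shows "lat_eq (LJoin s u) u"
proof -
  have "lat_eq (LJoin s u) (LJoin s (LJoin t u))"
    by (rule lat_eq_join_right, rule lat_eq_sym, rule assms)
  also have "lat_eq \<dots> (LJoin (LJoin s t) u)" by (rule lat_eq_sym, rule lat_eq_join_assoc)
  also have "lat_eq \<dots> (LJoin t u)" by (rule lat_eq_join_left, rule assms)
  also have "lat_eq \<dots> u" by (rule assms)
  finally show ?thesis .
qed

lemma carrier_free_lattice: "carrier (free_lattice X) = lclass X ` lterms X"
  by (auto simp: free_lattice_def lclass_def quotient_def)

lemma lclass_eq_iff:
  "s \<in> lterms X \<Longrightarrow> t \<in> lterms X \<Longrightarrow> lclass X s = lclass X t \<longleftrightarrow> lat_eq s t"
  unfolding lclass_def using eq_equiv_class_iff[OF equiv_lat_rel, of s X t] by (auto simp: lat_rel_def)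

lemma lclass_le_iff:
  assumes "s \<in> lterms X" "t \<in> lterms X"
  shows "lclass X s \<sqsubseteq>\<^bsub>free_lattice X\<^esub> lclass X t \<longleftrightarrow> lat_eq (LJoin s t) t"
proof -
  have "lat_eq (LJoin s t) t" if "lat_eq s s'" "lat_eq t t'" "lat_eq (LJoin s' t') t'" for s' t'
  proof -
    have "lat_eq (LJoin s t) (LJoin s' t')" by (rule lat_eq_cong_join) fact+
    also have "lat_eq \<dots> t'" by fact
    also have "lat_eq \<dots> t" by (rule lat_eq_sym) fact
    finally show ?thesis .
  qed
  with assms show ?thesis
    by (auto simp: free_lattice_def lclass_def lat_rel_def intro: lat_eq_refl)
qed

lemma lat_eq_join_upper: "lat_eq (LJoin s (LJoin s t)) (LJoin s t)"
proof -
  have "lat_eq (LJoin s (LJoin s t)) (LJoin (LJoin s s) t)"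
    by (rule lat_eq_sym, rule lat_eq_join_assoc)
  also have "lat_eq \<dots> (LJoin s t)" by (rule lat_eq_join_left, rule lat_eq_join_idem)
  finally show ?thesis .
qed

lemma lat_eq_join_upper2: "lat_eq (LJoin t (LJoin s t)) (LJoin s t)"
proof -
  have "lat_eq (LJoin t (LJoin s t)) (LJoin t (LJoin t s))"
    by (rule lat_eq_join_right, rule lat_eq_join_comm)
  also have "lat_eq \<dots> (LJoin t s)" by (rule lat_eq_join_upper)
  also have "lat_eq \<dots> (LJoin s t)" by (rule lat_eq_join_comm)
  finally show ?thesis .
qed

lemma lat_eq_join_least:
  assumes "lat_eq (LJoin s u) u" "lat_eq (LJoin t u) u"
  shows "lat_eq (LJoin (LJoin s t) u) u"
proof -
  have "lat_eq (LJoin (LJoin s t) u) (LJoin s (LJoin t u))" by (rule lat_eq_join_assoc)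
  also have "lat_eq \<dots> (LJoin s u)" by (rule lat_eq_join_right, rule assms)
  also have "lat_eq \<dots> u" by (rule assms)
  finally show ?thesis .
qed

lemma lat_eq_meet_lower: "lat_eq (LJoin (LMeet s t) s) s"
proof -
  have "lat_eq (LJoin (LMeet s t) s) (LJoin s (LMeet s t))" by (rule lat_eq_join_comm)
  also have "lat_eq \<dots> s" by (rule lat_eq_join_absorb)
  finally show ?thesis .
qed

lemma lat_eq_meet_lower2: "lat_eq (LJoin (LMeet s t) t) t"
proof -
  have "lat_eq (LJoin (LMeet s t) t) (LJoin (LMeet t s) t)"
    by (rule lat_eq_join_left, rule lat_eq_meet_comm)
  also have "lat_eq \<dots> t" by (rule lat_eq_meet_lower)
  finally show ?thesis .
qed

lemma lat_eq_meet_greatest: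
  assumes "lat_eq (LJoin u s) s" "lat_eq (LJoin u t) t"
  shows "lat_eq (LJoin u (LMeet s t)) (LMeet s t)"
proof -
  have "lat_eq (LMeet u (LMeet s t)) (LMeet (LMeet u s) t)"
    by (rule lat_eq_sym, rule lat_eq_meet_assoc)
  also have "lat_eq \<dots> (LMeet u t)"
    by (rule lat_eq_meet_left) (simp add: assms lat_eq_meet_iff_join)
  also have "lat_eq \<dots> u" by (simp add: assms lat_eq_meet_iff_join)
  finally show ?thesis by (simp add: lat_eq_meet_iff_join)
qed

lemma partial_order_free_lattice: "partial_order (free_lattice X)"
proof
  fix x y z
  assume x: "x \<in> carrier (free_lattice X)" and y: "y \<in> carrier (free_lattice X)"
  {
    assume "x \<sqsubseteq>\<^bsub>free_lattice X\<^esub> y" "y \<sqsubseteq>\<^bsub>free_lattice X\<^esub> x"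
    moreover obtain s t where "s \<in> lterms X" "t \<in> lterms X" "x = lclass X s" "y = lclass X t"
      using x y by (auto simp: carrier_free_lattice)
    ultimately have "x = y" by (simp add: lclass_le_iff lclass_eq_iff lat_eq_antisym)
    then show "x .=\<^bsub>free_lattice X\<^esub> y" by (simp add: free_lattice_def)
  }
  assume z: "z \<in> carrier (free_lattice X)"
  assume "x \<sqsubseteq>\<^bsub>free_lattice X\<^esub> y" "y \<sqsubseteq>\<^bsub>free_lattice X\<^esub> z"
  moreover obtain s t u where "s \<in> lterms X" "t \<in> lterms X" "u \<in> lterms X"
    "x = lclass X s" "y = lclass X t" "z = lclass X u"
    using x y z by (auto simp: carrier_free_lattice)
  ultimately show "x \<sqsubseteq>\<^bsub>free_lattice X\<^esub> z"
    using lat_eq_le_trans[of s t u] by (simp add: lclass_le_iff)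
next
  fix x assume "x \<in> carrier (free_lattice X)"
  then show "x \<sqsubseteq>\<^bsub>free_lattice X\<^esub> x"
    by (auto simp: carrier_free_lattice lclass_le_iff lat_eq_join_idem)
qed (auto simp: free_lattice_def)

lemma free_lattice_is_lub:
  assumes "s \<in> lterms X" "t \<in> lterms X"
  shows "is_lub (free_lattice X) (lclass X (LJoin s t)) {lclass X s, lclass X t}"
proof -
  let ?F = "free_lattice X"
  have cl: "lclass X u \<in> carrier ?F" if "u \<in> lterms X" for u
    using that by (simp add: carrier_free_lattice)
  have bd: "lclass X s \<sqsubseteq>\<^bsub>?F\<^esub> lclass X (LJoin s t)" "lclass X t \<sqsubseteq>\<^bsub>?F\<^esub> lclass X (LJoin s t)"
    using assms by (simp_all add: lclass_le_iff lat_eq_join_upper lat_eq_join_upper2)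
  have ext: "lclass X (LJoin s t) \<sqsubseteq>\<^bsub>?F\<^esub> A"
    if "A \<in> carrier ?F" "lclass X s \<sqsubseteq>\<^bsub>?F\<^esub> A" "lclass X t \<sqsubseteq>\<^bsub>?F\<^esub> A" for A
  proof -
    from that(1) obtain u where "u \<in> lterms X" "A = lclass X u"
      by (auto simp: carrier_free_lattice)
    then show ?thesis using that(2,3) assms by (simp add: lclass_le_iff lat_eq_join_least)
  qed
  show ?thesis
    unfolding least_def Upper_def using assms bd ext cl by simp
qed

lemma free_lattice_is_glb:
  assumes "s \<in> lterms X" "t \<in> lterms X"
  shows "is_glb (free_lattice X) (lclass X (LMeet s t)) {lclass X s, lclass X t}"
proof -
  let ?F = "free_lattice X"
  have cl: "lclass X u \<in> carrier ?F" if "u \<in> lterms X" for u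
    using that by (simp add: carrier_free_lattice)
  have bd: "lclass X (LMeet s t) \<sqsubseteq>\<^bsub>?F\<^esub> lclass X s" "lclass X (LMeet s t) \<sqsubseteq>\<^bsub>?F\<^esub> lclass X t"
    using assms by (simp_all add: lclass_le_iff lat_eq_meet_lower lat_eq_meet_lower2)
  have ext: "A \<sqsubseteq>\<^bsub>?F\<^esub> lclass X (LMeet s t)"
    if "A \<in> carrier ?F" "A \<sqsubseteq>\<^bsub>?F\<^esub> lclass X s" "A \<sqsubseteq>\<^bsub>?F\<^esub> lclass X t" for A
  proof -
    from that(1) obtain u where "u \<in> lterms X" "A = lclass X u"
      by (auto simp: carrier_free_lattice)
    then show ?thesis using that(2,3) assms by (simp add: lclass_le_iff lat_eq_meet_greatest)
  qed
  show ?thesis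
    unfolding greatest_def Lower_def using assms bd ext cl by simp
qed

theorem lattice_free_lattice: "lattice (free_lattice X)"
proof -
  interpret partial_order "free_lattice X" by (rule partial_order_free_lattice)
  show ?thesis
  proof
    fix x y assume "x \<in> carrier (free_lattice X)" "y \<in> carrier (free_lattice X)"
    then show "\<exists>s. is_lub (free_lattice X) s {x, y}" "\<exists>s. is_glb (free_lattice X) s {x, y}"
      unfolding carrier_free_lattice using free_lattice_is_lub free_lattice_is_glb by blast+
  qed
qed

lemma free_lattice_join:
  assumes "s \<in> lterms X" "t \<in> lterms X"
  shows "lclass X s \<squnion>\<^bsub>free_lattice X\<^esub> lclass X t = lclass X (LJoin s t)"
proof -
  interpret partial_order "free_lattice X" by (rule partial_order_free_lattice)
  show ?thesis
    unfolding join_def sup_def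
    using free_lattice_is_lub[OF assms] least_unique by (intro some_equality)
qed

lemma free_lattice_meet:
  assumes "s \<in> lterms X" "t \<in> lterms X"
  shows "lclass X s \<sqinter>\<^bsub>free_lattice X\<^esub> lclass X t = lclass X (LMeet s t)"
proof -
  interpret partial_order "free_lattice X" by (rule partial_order_free_lattice)
  show ?thesis
    unfolding meet_def inf_def
    using free_lattice_is_glb[OF assms] greatest_unique by (intro some_equality)
qed

primrec lterm_eval :: "('a, 'm) gorder_scheme \<Rightarrow> ('x \<Rightarrow> 'a) \<Rightarrow> 'x lterm \<Rightarrow> 'a" where
  "lterm_eval L g (LVar x) = g x"
| "lterm_eval L g (LJoin s t) = lterm_eval L g s \<squnion>\<^bsub>L\<^esub> lterm_eval L g t"
| "lterm_eval L g (LMeet s t) = lterm_eval L g s \<sqinter>\<^bsub>L\<^esub> lterm_eval L g t"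

lemma lterm_eval_closed:
  assumes "lattice L" "g \<in> X \<rightarrow> carrier L" "t \<in> lterms X"
  shows "lterm_eval L g t \<in> carrier L"
proof -
  interpret lattice L by fact
  show ?thesis using assms(2,3) by (induction t) auto
qed

lemma lterm_eval_lat_eq:
  assumes "lattice L" "\<And>x. g x \<in> carrier L" "lat_eq s t"
  shows "lterm_eval L g s = lterm_eval L g t"
proof -
  interpret lattice L by fact
  have cl: "lterm_eval L g u \<in> carrier L" for u
    by (rule lterm_eval_closed[of _ _ UNIV]) (use assms in \<open>auto simp: lterms_def\<close>)
  have absorb_join: "a \<squnion>\<^bsub>L\<^esub> (a \<sqinter>\<^bsub>L\<^esub> b) = a" if "a \<in> carrier L" "b \<in> carrier L" for a b
    using that le_iff_meet[of "a \<sqinter>\<^bsub>L\<^esub> b" a] meet_left[of a b]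
    by (simp add: join_comm[of L a])
  have absorb_meet: "a \<sqinter>\<^bsub>L\<^esub> (a \<squnion>\<^bsub>L\<^esub> b) = a" if "a \<in> carrier L" "b \<in> carrier L" for a b
    using that le_iff_join[of a "a \<squnion>\<^bsub>L\<^esub> b"] join_left[of a b] by simp
  have assoc: "lterm_eval L g (LJoin (LJoin s t) u) = lterm_eval L g (LJoin s (LJoin t u))"
    "lterm_eval L g (LMeet (LMeet s t) u) = lterm_eval L g (LMeet s (LMeet t u))" for s t u
    using weak_join_assoc[OF cl cl cl, of s t u] weak_meet_assoc[OF cl cl cl, of s t u]
    by (simp_all add: eq_is_equal)
  show ?thesis
    using assms(3)
  proof (induction rule: lat_eq.induct)
    case (lat_eq_join_comm s t)
    show ?case by (simp add: join_comm[of L "lterm_eval L g s"])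
  next
    case (lat_eq_meet_comm s t)
    show ?case by (simp add: meet_comm[of L "lterm_eval L g s"])
  next
    case (lat_eq_join_assoc s t u)
    show ?case by (rule assoc)
  next
    case (lat_eq_meet_assoc s t u)
    show ?case by (rule assoc)
  qed (simp_all add: cl absorb_join absorb_meet)
qed

theorem free_lattice_universal:
  fixes X :: "'x set"
  assumes L: "lattice L" and g: "g \<in> X \<rightarrow> carrier L"
  shows "\<exists>f. lattice_hom (free_lattice X) L f \<and> (\<forall>x\<in>X. f (lclass X (LVar x)) = g x) \<and>
    (\<forall>f'. lattice_hom (free_lattice X) L f' \<and> (\<forall>x\<in>X. f' (lclass X (LVar x)) = g x) \<longrightarrow>
       (\<forall>A \<in> carrier (free_lattice X). f' A = f A))"
proof -
  define f where "f A = lterm_eval L g (SOME t. t \<in> A)" for A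
  have f: "f (lclass X t) = lterm_eval L g t" if t: "t \<in> lterms X" for t
  proof -
    define s where "s = (SOME s. s \<in> lclass X t)"
    have "t \<in> lclass X t" using t by (auto simp: lclass_def lat_rel_def intro: lat_eq_refl)
    then have "s \<in> lclass X t" unfolding s_def by (rule someI)
    then have s: "s \<in> lterms X" "lat_eq t s" by (auto simp: lclass_def lat_rel_def)
    have "lvars t \<noteq> {}" for t :: "'x lterm" by (induction t) auto
    then obtain x0 where x0: "x0 \<in> lvars t" by blast
    then have "x0 \<in> X" using t by (auto simp: lterms_def)
    define h where "h x = (if x \<in> X then g x else g x0)" for x
    have h: "h x \<in> carrier L" for x using g \<open>x0 \<in> X\<close> by (auto simp: h_def)
    have eq: "lterm_eval L h u = lterm_eval L g u" if "u \<in> lterms X" for u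
      using that by (induction u) (auto simp: h_def)
    have "lterm_eval L h t = lterm_eval L h s"
      by (rule lterm_eval_lat_eq) (use L h s in auto)
    then show ?thesis using t s eq unfolding f_def s_def[symmetric] by simp
  qed
  have hom: "lattice_hom (free_lattice X) L f"
    unfolding lattice_hom_def join_pres_def meet_pres_def carrier_free_lattice
    using L lterm_eval_closed[OF L g]
    by (simp add: free_lattice_join free_lattice_meet f lattice_free_lattice Pi_iff)
  have uniq: "f' (lclass X t) = f (lclass X t)"
    if f': "lattice_hom (free_lattice X) L f'" "\<forall>x\<in>X. f' (lclass X (LVar x)) = g x"
      and "t \<in> lterms X" for f' t
    using \<open>t \<in> lterms X\<close>
  proof (induction t)
    case (LVar x)
    then show ?case using f' by (simp add: f)
  next
    case (LJoin s t)
    then have "f' (lclass X s \<squnion>\<^bsub>free_lattice X\<^esub> lclass X t) = f' (lclass X s) \<squnion>\<^bsub>L\<^esub> f' (lclass X t)"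
      using f' by (auto simp: lattice_hom_def join_pres_def carrier_free_lattice)
    then show ?case using LJoin by (simp add: free_lattice_join f)
  next
    case (LMeet s t)
    then have "f' (lclass X s \<sqinter>\<^bsub>free_lattice X\<^esub> lclass X t) = f' (lclass X s) \<sqinter>\<^bsub>L\<^esub> f' (lclass X t)"
      using f' by (auto simp: lattice_hom_def meet_pres_def carrier_free_lattice)
    then show ?case using LMeet by (simp add: free_lattice_meet f)
  qed
  show ?thesis
  proof (intro exI[of _ f] conjI allI impI ballI)
    show "lattice_hom (free_lattice X) L f" by (rule hom)
    show "f (lclass X (LVar x)) = g x" if "x \<in> X" for x using that by (simp add: f)
    show "f' A = f A"
      if "lattice_hom (free_lattice X) L f' \<and> (\<forall>x\<in>X. f' (lclass X (LVar x)) = g x)"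
        and "A \<in> carrier (free_lattice X)" for f' A
      using that uniq[of f'] by (force simp: carrier_free_lattice)
  qed
qed

end

theory Submission
  imports Defs "HOL-Library.Countable_Set"
begin

text \<open>
  Under the MCRP, the members of a minimal join-cover are join-irreducible, every element is a finite
  join of join-irreducibles, and a join-irreducible \<open>a\<close> lies in the join of two ideals \<open>I\<close> and \<open>J\<close>
  iff it lies in \<open>I \<union> J\<close> or some minimal join-cover of \<open>a\<close> is contained in \<open>I \<union> J\<close>.  The
  principal ideals of join-irreducibles form the leaven: minimal join-covers and the relation \<open>D\<close>
  between them reflect those of the semilattice.

  If \<open>b\<close> belongs to a minimal join-cover of \<open>a\<close>, then \<open>a D b\<close>.  As each \<open>a\<close> has only finitely many
  such \<open>b\<close> and there is no infinite \<open>D\<close>-sequence, each join-irreducible belongs to a finite set \<open>F\<close>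
  closed under minimal join-covers.  For such \<open>F\<close>, the map \<open>I \<mapsto> I \<inter> F\<close> is a lattice homomorphism
  onto a finite lattice, which is lower bounded because joins in it are computed by a well-founded
  covering relation.  These maps jointly separate the ideals.
\<close>

section \<open>Bounds in partial orders\<close>

lemma is_lub_iff:
  "A \<subseteq> carrier L \<Longrightarrow> is_lub L u A \<longleftrightarrow>
     u \<in> carrier L \<and> (\<forall>x\<in>A. x \<sqsubseteq>\<^bsub>L\<^esub> u) \<and> (\<forall>v\<in>carrier L. (\<forall>x\<in>A. x \<sqsubseteq>\<^bsub>L\<^esub> v) \<longrightarrow> u \<sqsubseteq>\<^bsub>L\<^esub> v)"
  by (auto simp: least_def Upper_def Int_absorb2 subset_iff)

lemma is_glb_iff:
  "A \<subseteq> carrier L \<Longrightarrow> is_glb L u A \<longleftrightarrow>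
     u \<in> carrier L \<and> (\<forall>x\<in>A. u \<sqsubseteq>\<^bsub>L\<^esub> x) \<and> (\<forall>v\<in>carrier L. (\<forall>x\<in>A. v \<sqsubseteq>\<^bsub>L\<^esub> x) \<longrightarrow> v \<sqsubseteq>\<^bsub>L\<^esub> u)"
  by (auto simp: greatest_def Lower_def subset_iff)

lemma (in partial_order) join_eqI: "is_lub L u {x, y} \<Longrightarrow> x \<squnion> y = u"
  unfolding join_def sup_def using least_unique by (intro some_equality)

lemma (in partial_order) meet_eqI: "is_glb L u {x, y} \<Longrightarrow> x \<sqinter> y = u"
  unfolding meet_def inf_def using greatest_unique by (intro some_equality)

lemma (in partial_order) is_lub_singleton_eq:
  "x \<in> carrier L \<Longrightarrow> is_lub L u {x} \<Longrightarrow> u = x"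
  using least_unique sup_of_singletonI by blast

lemma (in upper_semilattice) finite_is_lub:
  "finite X \<Longrightarrow> X \<subseteq> carrier L \<Longrightarrow> X \<noteq> {} \<Longrightarrow> \<exists>u. is_lub L u X"
  using finite_sup_least by blast

lemma (in upper_semilattice) is_lub_insert:
  assumes "x \<in> carrier L" "A \<subseteq> carrier L" "is_lub L c A"
  shows "is_lub L (x \<squnion> c) (insert x A)"
proof -
  have c: "c \<in> carrier L" using assms by simp
  have "a \<sqsubseteq> x \<squnion> c" if "a \<in> A" for a
    using that assms c join_right[of x c] le_trans[of a c "x \<squnion> c"] by (auto simp: is_lub_iff)
  then show ?thesis
    using assms c join_left[of x c] by (auto simp: is_lub_iff intro!: join_le)
qed

lemma (in upper_semilattice) lless_iff: "x \<sqsubset> y \<longleftrightarrow> x \<sqsubseteq> y \<and> x \<noteq> y"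
  by (simp add: lless_def eq_is_equal)

section \<open>The lattice of ideals\<close>

text \<open>The ideal generated by \<open>A\<close>. The case \<open>X = {}\<close> puts the zero
  element into the hull whenever there is one; without a zero, the hull of \<open>{}\<close> is
  empty.\<close>

definition ideal_hull :: "('a, 'm) gorder_scheme \<Rightarrow> 'a set \<Rightarrow> 'a set" where
  "ideal_hull S A = {z \<in> carrier S. \<exists>X u. finite X \<and> X \<subseteq> A \<and> is_lub S u X \<and> z \<sqsubseteq>\<^bsub>S\<^esub> u}"

lemma sl_ideal_subset: "sl_ideal S I \<Longrightarrow> I \<subseteq> carrier S"
  by (simp add: sl_ideal_def)

lemma sl_ideal_down: "sl_ideal S I \<Longrightarrow> down S I \<subseteq> I"
  by (simp add: sl_ideal_def)

lemma sl_ideal_mono: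
  "sl_ideal S I \<Longrightarrow> x \<in> I \<Longrightarrow> y \<in> carrier S \<Longrightarrow> y \<sqsubseteq>\<^bsub>S\<^esub> x \<Longrightarrow> y \<in> I"
  by (auto simp: sl_ideal_def down_def)

lemma sl_ideal_lub:
  "sl_ideal S I \<Longrightarrow> finite X \<Longrightarrow> X \<subseteq> I \<Longrightarrow> is_lub S u X \<Longrightarrow> u \<in> I"
  by (auto simp: sl_ideal_def)

lemma ideal_hull_subset: "sl_ideal S I \<Longrightarrow> A \<subseteq> I \<Longrightarrow> ideal_hull S A \<subseteq> I"
proof
  fix z assume I: "sl_ideal S I" "A \<subseteq> I" and "z \<in> ideal_hull S A"
  then obtain X u where z: "z \<in> carrier S" "z \<sqsubseteq>\<^bsub>S\<^esub> u" and X: "finite X" "X \<subseteq> A" "is_lub S u X"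
    by (auto simp: ideal_hull_def)
  have "u \<in> I" using sl_ideal_lub[OF I(1) X(1) _ X(3)] X(2) I(2) by blast
  then show "z \<in> I" using sl_ideal_mono[OF I(1)] z by blast
qed

lemma sl_ideal_Int:
  "sl_ideal S I \<Longrightarrow> sl_ideal S J \<Longrightarrow> sl_ideal S (I \<inter> J)"
  by (auto simp: sl_ideal_def down_def)

lemma carrier_ideal_lattice [simp]: "I \<in> carrier (ideal_lattice S) \<longleftrightarrow> sl_ideal S I"
  and le_ideal_lattice [simp]: "I \<sqsubseteq>\<^bsub>ideal_lattice S\<^esub> J \<longleftrightarrow> I \<subseteq> J"
  and lless_ideal_lattice [simp]: "I \<sqsubset>\<^bsub>ideal_lattice S\<^esub> J \<longleftrightarrow> I \<subset> J"
  by (auto simp: ideal_lattice_def lless_def)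

lemma partial_order_ideal_lattice: "partial_order (ideal_lattice S)"
  by standard (auto simp: ideal_lattice_def)

lemma is_glb_ideals:
  "sl_ideal S I \<Longrightarrow> sl_ideal S J \<Longrightarrow> is_glb (ideal_lattice S) (I \<inter> J) {I, J}"
  by (subst is_glb_iff) (auto intro: sl_ideal_Int)

context upper_semilattice
begin

lemma ideal_hull_superset: "A \<subseteq> carrier L \<Longrightarrow> A \<subseteq> ideal_hull L A"
proof
  fix x assume "A \<subseteq> carrier L" "x \<in> A"
  then have "x \<in> carrier L" by blast
  then show "x \<in> ideal_hull L A"
    unfolding ideal_hull_def using \<open>x \<in> A\<close> sup_of_singletonI
    by (intro CollectI conjI exI[of _ "{x}"] exI[of _ x]) auto
qed

lemma sl_ideal_hull:
  assumes A: "A \<subseteq> carrier L"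
  shows "sl_ideal L (ideal_hull L A)"
  unfolding sl_ideal_def
proof (intro conjI allI impI)
  show "ideal_hull L A \<subseteq> carrier L" by (auto simp: ideal_hull_def)
  show "down L (ideal_hull L A) \<subseteq> ideal_hull L A"
  proof
    fix y assume "y \<in> down L (ideal_hull L A)"
    then obtain x X u where *: "y \<in> carrier L" "x \<in> carrier L" "y \<sqsubseteq> x" "finite X" "X \<subseteq> A"
      "is_lub L u X" "x \<sqsubseteq> u"
      by (auto simp: down_def ideal_hull_def)
    then have "y \<sqsubseteq> u" using le_trans[of y x u] by simp
    with * show "y \<in> ideal_hull L A" by (auto simp: ideal_hull_def)
  qed
next
  fix Y u assume Y: "finite Y" "Y \<subseteq> ideal_hull L A" and u: "is_lub L u Y"
  have "\<forall>y\<in>Y. \<exists>X v. finite X \<and> X \<subseteq> A \<and> is_lub L v X \<and> y \<sqsubseteq> v"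
    using Y unfolding ideal_hull_def by blast
  then obtain X v where Xv: "\<And>y. y \<in> Y \<Longrightarrow> finite (X y) \<and> X y \<subseteq> A \<and> is_lub L (v y) (X y) \<and> y \<sqsubseteq> v y"
    by metis
  define Z where "Z = \<Union>(X ` Y)"
  have Z: "finite Z" "Z \<subseteq> A" using Xv Y by (auto simp: Z_def)
  have YL: "Y \<subseteq> carrier L" using Y by (auto simp: ideal_hull_def)
  \<comment> \<open>Only \<open>Z = {}\<close> is delicate, because a zero has to be produced:
    either \<open>Y\<close> is empty and \<open>u\<close> is one, or some \<open>X y\<close> is
    empty and \<open>v y\<close> is one.\<close>
  have "\<exists>w. is_lub L w Z"
  proof (cases "Z = {}")
    case False
    moreover have "Z \<subseteq> carrier L" using Z A by blast
    ultimately show ?thesis using finite_is_lub Z(1) by simp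
  next
    case True
    show ?thesis
    proof (cases "Y = {}")
      case True
      then show ?thesis using u \<open>Z = {}\<close> by blast
    next
      case False
      then obtain y where "y \<in> Y" by blast
      then show ?thesis using Xv[of y] True by (auto simp: Z_def)
    qed
  qed
  then obtain w where w: "is_lub L w Z" by blast
  have ZL: "Z \<subseteq> carrier L" using Z A by blast
  have "y \<sqsubseteq> w" if y: "y \<in> Y" for y
  proof -
    have "X y \<subseteq> carrier L" using Xv[OF y] A by blast
    moreover have "X y \<subseteq> Z" using y by (auto simp: Z_def)
    ultimately have "v y \<sqsubseteq> w"
      using Xv[OF y] w ZL by (simp add: is_lub_iff subset_iff)
    moreover have "v y \<in> carrier L" "w \<in> carrier L" using Xv[OF y] w by auto
    ultimately show ?thesis using le_trans[of y "v y" w] Xv[OF y] YL y by auto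
  qed
  then have "u \<sqsubseteq> w" using u w YL by (auto simp: is_lub_iff)
  then show "u \<in> ideal_hull L A"
    unfolding ideal_hull_def using u w Z by auto
qed

section \<open>Principal ideals and joins of ideals\<close>

lemma sl_ideal_down_singleton:
  assumes p: "p \<in> carrier L"
  shows "sl_ideal L (down L {p})"
  unfolding sl_ideal_def
proof (intro conjI allI impI)
  show "down L {p} \<subseteq> carrier L" by (auto simp: down_def)
  show "down L (down L {p}) \<subseteq> down L {p}"
  proof
    fix y assume "y \<in> down L (down L {p})"
    then obtain x where "y \<in> carrier L" "x \<in> carrier L" "y \<sqsubseteq> x" "x \<sqsubseteq> p" by (auto simp: down_def)
    then show "y \<in> down L {p}" using le_trans[of y x p] p by (simp add: down_def)
  qed
  fix X u assume "X \<subseteq> down L {p}" "is_lub L u X"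
  moreover from this have "X \<subseteq> carrier L" by (auto simp: down_def)
  ultimately show "u \<in> down L {p}" using p by (auto simp: down_def is_lub_iff)
qed

lemma down_singleton_subset_iff:
  "p \<in> carrier L \<Longrightarrow> sl_ideal L I \<Longrightarrow> down L {p} \<subseteq> I \<longleftrightarrow> p \<in> I"
  using sl_ideal_mono[of L I p] by (auto simp: down_def)

lemma down_singleton_inject:
  "p \<in> carrier L \<Longrightarrow> q \<in> carrier L \<Longrightarrow> down L {p} = down L {q} \<Longrightarrow> p = q"
  using le_refl[of p] le_refl[of q] le_antisym[of p q] unfolding down_def by blast

text \<open>Stated for arbitrary families: infinite ones serve join-generation, and the empty one
  describes the zero of the ideal lattice.\<close>

lemma is_lub_ideals_iff:
  assumes "\<And>I. I \<in> \<X> \<Longrightarrow> sl_ideal L I"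
  shows "is_lub (ideal_lattice L) K \<X> \<longleftrightarrow> K = ideal_hull L (\<Union>\<X>)"
proof -
  have sub: "\<Union>\<X> \<subseteq> carrier L" using assms sl_ideal_subset by blast
  have "is_lub (ideal_lattice L) (ideal_hull L (\<Union>\<X>)) \<X>"
  proof (subst is_lub_iff, safe)
    show "I \<in> carrier (ideal_lattice L)" if "I \<in> \<X>" for I using assms that by simp
    show "ideal_hull L (\<Union>\<X>) \<in> carrier (ideal_lattice L)" using sl_ideal_hull[OF sub] by simp
    show "I \<sqsubseteq>\<^bsub>ideal_lattice L\<^esub> ideal_hull L (\<Union>\<X>)" if "I \<in> \<X>" for I
      using ideal_hull_superset[OF sub] that by auto
    show "ideal_hull L (\<Union>\<X>) \<sqsubseteq>\<^bsub>ideal_lattice L\<^esub> J"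
      if "J \<in> carrier (ideal_lattice L)" "\<forall>I\<in>\<X>. I \<sqsubseteq>\<^bsub>ideal_lattice L\<^esub> J" for J
      using that ideal_hull_subset[of L J "\<Union>\<X>"] by auto
  qed
  then show ?thesis
    using partial_order.least_unique[OF partial_order_ideal_lattice] by metis
qed

lemma lattice_ideal_lattice: "lattice (ideal_lattice L)"
proof -
  interpret Id: partial_order "ideal_lattice L" by (rule partial_order_ideal_lattice)
  show ?thesis
  proof
    fix I J assume "I \<in> carrier (ideal_lattice L)" "J \<in> carrier (ideal_lattice L)"
    then show "\<exists>s. is_lub (ideal_lattice L) s {I, J}" "\<exists>s. is_glb (ideal_lattice L) s {I, J}"
      using is_lub_ideals_iff[of "{I, J}"] is_glb_ideals[of L I J] by auto
  qed
qed

lemma join_ideals: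
  "sl_ideal L I \<Longrightarrow> sl_ideal L J \<Longrightarrow> I \<squnion>\<^bsub>ideal_lattice L\<^esub> J = ideal_hull L (I \<union> J)"
  using is_lub_ideals_iff[of "{I, J}"]
  by (intro partial_order.join_eqI[OF partial_order_ideal_lattice]) auto

lemma meet_ideals:
  "sl_ideal L I \<Longrightarrow> sl_ideal L J \<Longrightarrow> I \<sqinter>\<^bsub>ideal_lattice L\<^esub> J = I \<inter> J"
  by (intro partial_order.meet_eqI[OF partial_order_ideal_lattice] is_glb_ideals)

section \<open>Minimal join-covers\<close>

lemma not_nonzero_le: "p \<in> nonzero L \<Longrightarrow> is_zero L z \<Longrightarrow> \<not> p \<sqsubseteq> z"
  unfolding nonzero_def is_zero_def least_def
  using le_trans[of p z] by auto

text \<open>Induction on \<open>X\<close> splits off one element at a time, so the binary definition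
  of irreducibility suffices; the empty join is excluded because \<open>p\<close> is not
  zero.\<close>

lemma join_irreducible_mem_of_is_lub:
  assumes "finite X" "X \<subseteq> carrier L" "p \<in> join_irreducibles L" "is_lub L p X"
  shows "p \<in> X"
  using assms
proof (induction X)
  case empty
  then show ?case by (auto simp: join_irreducibles_def nonzero_def is_lub_empty_iff[symmetric])
next
  case (insert x X)
  show ?case
  proof (cases "X = {}")
    case True
    then show ?thesis using insert.prems is_lub_singleton_eq[of x p] by simp
  next
    case False
    then obtain c where c: "is_lub L c X" using insert finite_is_lub[of X] by auto
    then have "p = x \<squnion> c"
      using is_lub_insert[of x X c] insert.prems least_unique by blast
    moreover have "x \<sqsubseteq> p" "c \<sqsubseteq> p"
      using \<open>p = x \<squnion> c\<close> join_left[of x c] join_right[of x c] c insert.prems by auto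
    moreover have "x \<in> carrier L" "c \<in> carrier L" using c insert.prems by auto
    ultimately have "p = x \<or> p = c"
      using insert.prems(2) unfolding join_irreducibles_def lless_iff mem_Collect_eq by metis
    then show ?thesis using insert c by auto
  qed
qed

lemma refines_subset: "X \<subseteq> Y \<Longrightarrow> Y \<subseteq> carrier L \<Longrightarrow> refines L X Y"
  unfolding refines_def down_def using le_refl by blast

text \<open>Nontriviality is inherited by refinements: if \<open>a\<close> were below some
  \<open>x\<close> in \<open>X\<close>, it would be below the element of \<open>E\<close> above
  \<open>x\<close>.\<close>

lemma join_covers_replace:
  assumes E: "E \<in> join_covers L a" and X: "finite X" "X \<subseteq> carrier L" "refines L X E"
    and u: "is_lub L u X" "a \<sqsubseteq> u" and a: "a \<in> carrier L"
  shows "X \<in> join_covers L a"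
proof -
  have EL: "E \<subseteq> carrier L" using E by (simp add: join_covers_def)
  have "a \<notin> down L X"
  proof
    assume "a \<in> down L X"
    then obtain x e where *: "x \<in> X" "a \<sqsubseteq> x" "e \<in> E" "x \<sqsubseteq> e"
      using X by (auto simp: down_def refines_def)
    then have "x \<in> carrier L" "e \<in> carrier L" using X EL by auto
    then have "a \<sqsubseteq> e" using le_trans[of a x e] a * by simp
    then show False using E a \<open>e \<in> E\<close> by (auto simp: join_covers_def down_def)
  qed
  then show ?thesis using X u by (auto simp: join_covers_def)
qed

text \<open>The form in which minimality is used below: lowering or splitting members of
  \<open>E\<close> while keeping the join above \<open>a\<close> cannot lose a member of
  \<open>E\<close>.\<close>

lemma minimal_join_cover_replace:
  assumes E: "E \<in> minimal_join_covers L a" and a: "a \<in> carrier L"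
    and X: "finite X" "X \<subseteq> carrier L" "refines L X E" "is_lub L u X" "a \<sqsubseteq> u"
  shows "E \<subseteq> X"
  using E X join_covers_replace[OF _ X(1-5) a] by (auto simp: minimal_join_covers_def)

lemma minimal_join_coverE:
  assumes "E \<in> minimal_join_covers L a" "a \<in> nonzero L"
  obtains u where "finite E" "E \<subseteq> carrier L" "is_lub L u E" "a \<sqsubseteq> u" "a \<in> carrier L"
    "\<forall>e\<in>E. \<not> a \<sqsubseteq> e" "E \<noteq> {}"
proof -
  obtain u where u: "finite E" "E \<subseteq> carrier L" "is_lub L u E" "a \<sqsubseteq> u" "a \<notin> down L E"
    using assms by (auto simp: minimal_join_covers_def join_covers_def)
  then have "E \<noteq> {}"
    using assms not_nonzero_le is_lub_empty_iff[of L u] by auto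
  then show thesis using that u assms by (auto simp: down_def nonzero_def)
qed

text \<open>\<open>E\<close> has a member other than \<open>b\<close>, since otherwise
  \<open>a\<close> would be below \<open>b\<close>. Hence the join \<open>c\<close> of the rest
  exists even when there is no zero.\<close>

lemma minimal_join_cover_decompose:
  assumes E: "E \<in> minimal_join_covers L a" and a: "a \<in> nonzero L" and b: "b \<in> E"
  obtains c where "is_lub L c (E - {b})" "E - {b} \<noteq> {}" "c \<in> carrier L" "is_lub L (b \<squnion> c) E"
    "a \<sqsubseteq> b \<squnion> c"
proof -
  obtain u where u: "finite E" "E \<subseteq> carrier L" "is_lub L u E" "a \<sqsubseteq> u" "a \<in> carrier L"
      "\<forall>e\<in>E. \<not> a \<sqsubseteq> e" "E \<noteq> {}"
    by (rule minimal_join_coverE[OF E a])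
  have ne: "E - {b} \<noteq> {}"
  proof
    assume "E - {b} = {}"
    then have "E = {b}" using b by blast
    then show False using u is_lub_singleton_eq[of b u] by auto
  qed
  have sub: "E - {b} \<subseteq> carrier L" "finite (E - {b})" using u by auto
  then obtain c where c: "is_lub L c (E - {b})" using ne finite_is_lub by blast
  have "is_lub L (b \<squnion> c) E"
    using is_lub_insert[OF _ sub(1) c, of b] b u by (auto simp: insert_absorb)
  moreover from this have "a \<sqsubseteq> b \<squnion> c" using u least_unique by blast
  moreover have "c \<in> carrier L" using c by simp
  ultimately show thesis using that c ne by blast
qed

text \<open>A zero \<open>b\<close> could be dropped from \<open>E\<close>, and
  \<open>b = x \<squnion> y\<close> with smaller \<open>x\<close> and \<open>y\<close> could be
  replaced by these two. In both cases a refining join-cover of \<open>a\<close> misses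
  \<open>b\<close>, against minimality.\<close>

lemma minimal_join_cover_irreducible:
  assumes E: "E \<in> minimal_join_covers L a" and a: "a \<in> nonzero L"
  shows "E \<subseteq> join_irreducibles L"
proof
  fix b assume b: "b \<in> E"
  obtain u where u: "finite E" "E \<subseteq> carrier L" "is_lub L u E" "a \<sqsubseteq> u" "a \<in> carrier L"
      "\<forall>e\<in>E. \<not> a \<sqsubseteq> e" "E \<noteq> {}"
    by (rule minimal_join_coverE[OF E a])
  have bL: "b \<in> carrier L" using b u by blast
  obtain c where c: "is_lub L c (E - {b})" "E - {b} \<noteq> {}" "c \<in> carrier L" "is_lub L (b \<squnion> c) E"
      "a \<sqsubseteq> b \<squnion> c"
    by (rule minimal_join_cover_decompose[OF E a b])
  have sub: "E - {b} \<subseteq> carrier L" "finite (E - {b})" using u by auto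
  have ref: "refines L (E - {b}) E" using u by (intro refines_subset) auto
  show "b \<in> join_irreducibles L"
  proof (rule ccontr)
    assume "b \<notin> join_irreducibles L"
    then consider "is_zero L b"
      | x y where "x \<in> carrier L" "y \<in> carrier L" "x \<sqsubset> b" "y \<sqsubset> b" "b = x \<squnion> y"
      using bL unfolding join_irreducibles_def nonzero_def by blast
    then show False
    proof cases
      case 1
      then have "b \<sqsubseteq> c" using c by (auto simp: is_zero_def least_def)
      then have "b \<squnion> c \<sqsubseteq> c" using join_le[of b c c] bL c by simp
      then have "a \<sqsubseteq> c" using le_trans[of a "b \<squnion> c" c] u(5) bL c by simp
      then have "E \<subseteq> E - {b}" using minimal_join_cover_replace[OF E u(5) sub(2,1) ref] c by blast
      then show False using b by blast
    next
      case 2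
      let ?X = "insert x (insert y (E - {b}))"
      have lub: "is_lub L (x \<squnion> (y \<squnion> c)) ?X"
        by (intro is_lub_insert) (use 2 sub c in auto)
      have "b \<squnion> c = x \<squnion> (y \<squnion> c)"
        using weak_join_assoc[of x y c] 2 c by (simp add: eq_is_equal)
      then have "a \<sqsubseteq> x \<squnion> (y \<squnion> c)" using c by simp
      moreover have "refines L ?X E"
        using ref 2 b by (auto simp: refines_def down_def lless_iff)
      ultimately have "E \<subseteq> ?X"
        using minimal_join_cover_replace[OF E u(5), of ?X] lub 2 sub by auto
      then show False using b 2 by (auto simp: lless_iff)
    qed
  qed
qed

text \<open>The join \<open>c\<close> of \<open>E - {b}\<close> witnesses the dependency: if
  \<open>x\<close> is strictly below \<open>b\<close> and
  \<open>a \<sqsubseteq> x \<squnion> c\<close>, then \<open>insert x (E - {b})\<close> is a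
  refining join-cover that misses \<open>b\<close>.\<close>

lemma minimal_join_cover_join_dep:
  assumes E: "E \<in> minimal_join_covers L a" and a: "a \<in> join_irreducibles L" and b: "b \<in> E"
  shows "join_dep L a b"
proof -
  have a0: "a \<in> nonzero L" using a by (simp add: join_irreducibles_def)
  obtain u where u: "finite E" "E \<subseteq> carrier L" "is_lub L u E" "a \<sqsubseteq> u" "a \<in> carrier L"
      "\<forall>e\<in>E. \<not> a \<sqsubseteq> e" "E \<noteq> {}"
    by (rule minimal_join_coverE[OF E a0])
  obtain c where c: "is_lub L c (E - {b})" "E - {b} \<noteq> {}" "c \<in> carrier L" "is_lub L (b \<squnion> c) E"
      "a \<sqsubseteq> b \<squnion> c"
    by (rule minimal_join_cover_decompose[OF E a0 b])
  have "\<not> a \<sqsubseteq> x \<squnion> c" if x: "x \<in> carrier L" "x \<sqsubset> b" for x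
  proof
    assume "a \<sqsubseteq> x \<squnion> c"
    moreover have "is_lub L (x \<squnion> c) (insert x (E - {b}))"
      by (intro is_lub_insert) (use x u c in auto)
    moreover have "refines L (insert x (E - {b})) E"
      using x b refines_subset[of "E - {b}" E] u by (auto simp: refines_def down_def lless_iff)
    ultimately have "E \<subseteq> insert x (E - {b})"
      using minimal_join_cover_replace[OF E u(5), of "insert x (E - {b})"] u x by auto
    then show False using b x by (auto simp: lless_iff)
  qed
  moreover have "a \<noteq> b" using u b by blast
  moreover have "b \<in> join_irreducibles L" using minimal_join_cover_irreducible[OF E a0] b by blast
  ultimately show ?thesis using a c by (auto simp: join_dep_def)
qed

section \<open>Consequences of the MCRP\<close>

lemma MCRP_refine:
  assumes "MCRP L" "p \<in> nonzero L" "X \<in> join_covers L p"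
  obtains E where "E \<in> minimal_join_covers L p" "refines L E X"
  using assms by (fastforce simp: MCRP_def MCRP_on_def minimal_join_covers_in_def nonzero_def)

lemma MCRP_finite: "MCRP L \<Longrightarrow> p \<in> nonzero L \<Longrightarrow> finite (minimal_join_covers L p)"
proof -
  assume "MCRP L" "p \<in> nonzero L"
  then have "finite (minimal_join_covers_in L (carrier L) p)"
    by (auto simp: MCRP_def MCRP_on_def nonzero_def)
  moreover have "minimal_join_covers_in L (carrier L) p = minimal_join_covers L p"
    by (auto simp: minimal_join_covers_in_def minimal_join_covers_def join_covers_def)
  ultimately show ?thesis by simp
qed

text \<open>A reducible \<open>a\<close> is the join of smaller \<open>x\<close> and
  \<open>y\<close>, so \<open>{x, y}\<close> is a nontrivial join-cover. A minimal cover refining it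
  has all its members below \<open>a\<close>, so its join is exactly \<open>a\<close>, and its
  members are join-irreducible.\<close>

lemma finite_join_of_irreducibles:
  assumes M: "MCRP L" and a: "a \<in> carrier L"
  shows "\<exists>X \<subseteq> join_irreducibles L. finite X \<and> is_lub L a X"
proof -
  consider "is_zero L a" | "a \<in> join_irreducibles L"
    | x y where "x \<in> carrier L" "y \<in> carrier L" "x \<sqsubset> a" "y \<sqsubset> a" "a = x \<squnion> y" "a \<in> nonzero L"
    using a unfolding join_irreducibles_def nonzero_def by blast
  then show ?thesis
  proof cases
    case 1
    then show ?thesis by (intro exI[of _ "{}"]) (simp add: is_lub_empty_iff[symmetric])
  next
    case 2
    then show ?thesis using a sup_of_singletonI by (intro exI[of _ "{a}"]) auto
  next
    case 3
    have "a \<notin> down L {x, y}" using 3 by (auto simp: down_def lless_iff)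
    moreover have "is_lub L a {x, y}" using 3 sup_of_two_least[of x y] by (simp add: join_def)
    ultimately have "{x, y} \<in> join_covers L a" using 3 a by (auto simp: join_covers_def)
    then obtain E where E: "E \<in> minimal_join_covers L a" "refines L E {x, y}"
      using MCRP_refine[OF M] 3 by blast
    then obtain u where u: "finite E" "E \<subseteq> carrier L" "is_lub L u E" "a \<sqsubseteq> u" "a \<in> carrier L"
      "\<forall>e\<in>E. \<not> a \<sqsubseteq> e" "E \<noteq> {}"
      using minimal_join_coverE[OF E(1) 3(6)] by metis
    have "e \<sqsubseteq> a" if "e \<in> E" for e
      using that E 3 le_trans[of e x a] le_trans[of e y a] a u
      by (auto simp: refines_def down_def lless_iff)
    then have "u = a" using u a by (auto simp: is_lub_iff intro: le_antisym)
    then show ?thesis using u minimal_join_cover_irreducible[OF E(1)] 3 by blast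
  qed
qed

text \<open>A finite subset of \<open>A\<close> with join above \<open>a\<close> either has a member
  above \<open>a\<close> or is a nontrivial join-cover; in the second case a minimal cover refining
  it stays in the lower set \<open>A\<close>. Asking only for a lower set admits unions of
  ideals.\<close>

lemma mem_ideal_hull_iff:
  assumes M: "MCRP L" and a: "a \<in> nonzero L" and A: "A \<subseteq> carrier L" "down L A \<subseteq> A"
  shows "a \<in> ideal_hull L A \<longleftrightarrow> a \<in> A \<or> (\<exists>E\<in>minimal_join_covers L a. E \<subseteq> A)"
proof
  have aL: "a \<in> carrier L" using a by (simp add: nonzero_def)
  have dm: "down L X \<subseteq> A" if "X \<subseteq> A" for X using that A by (auto simp: down_def)
  assume "a \<in> ideal_hull L A"
  then obtain X u where X: "finite X" "X \<subseteq> A" "is_lub L u X" "a \<sqsubseteq> u"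
    by (auto simp: ideal_hull_def)
  show "a \<in> A \<or> (\<exists>E\<in>minimal_join_covers L a. E \<subseteq> A)"
  proof (cases "a \<in> down L X")
    case True
    then show ?thesis using dm X by blast
  next
    case False
    then have "X \<in> join_covers L a" using X A by (auto simp: join_covers_def)
    then show ?thesis
      using MCRP_refine[OF M a] dm[OF X(2)] by (metis refines_def subset_trans)
  qed
next
  assume "a \<in> A \<or> (\<exists>E\<in>minimal_join_covers L a. E \<subseteq> A)"
  then show "a \<in> ideal_hull L A"
    using ideal_hull_superset[OF A(1)] a
    by (auto simp: ideal_hull_def minimal_join_covers_def join_covers_def nonzero_def)
qed

end

section \<open>Fermentability of the ideal lattice\<close>

context upper_semilattice
begin

lemma is_zero_ideal_lattice_iff: "is_zero (ideal_lattice L) Z \<longleftrightarrow> Z = ideal_hull L {}"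
  using is_lub_ideals_iff[of "{}" Z] by (simp only: is_lub_empty_iff) simp

lemma mem_down_singleton [simp]: "p \<in> carrier L \<Longrightarrow> p \<in> down L {p}"
  by (simp add: down_def)

text \<open>If \<open>down L {p}\<close> is the join of \<open>I\<close> and \<open>J\<close>, both
  inside it, then \<open>p\<close> lies below the join of a finite
  \<open>X \<subseteq> I \<union> J\<close>. All of \<open>X\<close> is below \<open>p\<close>, so
  this join is \<open>p\<close>; irreducibility gives \<open>p \<in> X\<close>, and one of the two
  ideals is not strictly smaller.\<close>

lemma down_singleton_irreducible:
  assumes p: "p \<in> join_irreducibles L"
  shows "down L {p} \<in> join_irreducibles (ideal_lattice L)"
proof -
  have pL: "p \<in> carrier L" using p by (simp add: join_irreducibles_def nonzero_def)
  have "\<not> is_zero (ideal_lattice L) (down L {p})"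
  proof
    assume "is_zero (ideal_lattice L) (down L {p})"
    then have "p \<in> ideal_hull L {}"
      using mem_down_singleton[OF pL] unfolding is_zero_ideal_lattice_iff by simp
    then show False
      using p not_nonzero_le by (auto simp: ideal_hull_def join_irreducibles_def is_lub_empty_iff[symmetric])
  qed
  moreover have False
    if I: "sl_ideal L I" "I \<subset> down L {p}" and J: "sl_ideal L J" "J \<subset> down L {p}"
      and eq: "down L {p} = I \<squnion>\<^bsub>ideal_lattice L\<^esub> J" for I J
  proof -
    have "p \<in> ideal_hull L (I \<union> J)" using eq mem_down_singleton[OF pL] join_ideals[OF I(1) J(1)] by simp
    then obtain X u where X: "finite X" "X \<subseteq> I \<union> J" "is_lub L u X" "p \<sqsubseteq> u"
      by (auto simp: ideal_hull_def)
    have sub: "X \<subseteq> down L {p}" using X I J by auto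
    then have XL: "X \<subseteq> carrier L" by (auto simp: down_def)
    have "u \<sqsubseteq> p" using X(3) sub pL XL by (auto simp: is_lub_iff down_def)
    then have "u = p" using X pL by (intro le_antisym) auto
    then have "p \<in> X" using join_irreducible_mem_of_is_lub X XL p by blast
    then have "p \<in> I \<or> p \<in> J" using X by blast
    then show False
      using I J down_singleton_subset_iff[OF pL I(1)] down_singleton_subset_iff[OF pL J(1)] by auto
  qed
  ultimately show ?thesis
    unfolding join_irreducibles_def nonzero_def mem_Collect_eq Bex_def carrier_ideal_lattice lless_ideal_lattice
    using sl_ideal_down_singleton[OF pL] by blast
qed

text \<open>An ideal contains \<open>down L {p}\<close> exactly when it contains \<open>p\<close>;
  this turns covers by ideals into conditions on the element \<open>p\<close>.\<close>

lemma join_covers_down_singleton_iff: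
  assumes p: "p \<in> carrier L"
  shows "\<X> \<in> join_covers (ideal_lattice L) (down L {p}) \<longleftrightarrow>
    finite \<X> \<and> (\<forall>I\<in>\<X>. sl_ideal L I) \<and> p \<notin> \<Union>\<X> \<and> p \<in> ideal_hull L (\<Union>\<X>)"
proof (cases "\<forall>I\<in>\<X>. sl_ideal L I")
  case True
  then have "\<Union>\<X> \<subseteq> carrier L" using sl_ideal_subset by blast
  then have "down L {p} \<subseteq> ideal_hull L (\<Union>\<X>) \<longleftrightarrow> p \<in> ideal_hull L (\<Union>\<X>)"
    using down_singleton_subset_iff[OF p] sl_ideal_hull by blast
  moreover have "down L {p} \<in> down (ideal_lattice L) \<X> \<longleftrightarrow> p \<in> \<Union>\<X>"
    using True p sl_ideal_down_singleton[OF p] down_singleton_subset_iff[OF p]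
    by (auto simp: down_def[of "ideal_lattice L"])
  ultimately show ?thesis
    using True is_lub_ideals_iff[of \<X>] by (auto simp: join_covers_def)
next
  case False
  then show ?thesis by (auto simp: join_covers_def)
qed

lemma join_cover_of_mem_ideal_hull:
  assumes A: "A \<subseteq> carrier L" "down L A \<subseteq> A" and p: "p \<in> carrier L" "p \<notin> A" "p \<in> ideal_hull L A"
  obtains X where "X \<in> join_covers L p" "X \<subseteq> A"
proof -
  obtain X u where X: "finite X" "X \<subseteq> A" "is_lub L u X" "p \<sqsubseteq> u"
    using p by (auto simp: ideal_hull_def)
  moreover have "p \<notin> down L X" using p A X by (auto simp: down_def)
  ultimately show thesis using that[of X] A by (auto simp: join_covers_def)
qed

lemma join_cover_of_ideal_join_cover:
  assumes p: "p \<in> carrier L" and X: "\<X> \<in> join_covers (ideal_lattice L) (down L {p})"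
  obtains X where "X \<in> join_covers L p" "X \<subseteq> \<Union>\<X>" "down L (\<Union>\<X>) \<subseteq> \<Union>\<X>" "\<forall>I\<in>\<X>. sl_ideal L I"
proof -
  have *: "\<forall>I\<in>\<X>. sl_ideal L I" "p \<notin> \<Union>\<X>" "p \<in> ideal_hull L (\<Union>\<X>)"
    using X by (simp_all add: join_covers_down_singleton_iff[OF p])
  have "down L (\<Union>\<X>) \<subseteq> \<Union>\<X>" "\<Union>\<X> \<subseteq> carrier L"
    using *(1) by (auto simp: sl_ideal_def down_def)
  then obtain X where "X \<in> join_covers L p" "X \<subseteq> \<Union>\<X>"
    using join_cover_of_mem_ideal_hull[OF _ _ p *(2,3)] by metis
  then show thesis using that \<open>down L (\<Union>\<X>) \<subseteq> \<Union>\<X>\<close> *(1) by metis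
qed

text \<open>The principal ideals of \<open>E\<close> have union \<open>down L E\<close>, and for
  nonempty \<open>E\<close> every join of a finite subset of this union lies below the join of
  \<open>E\<close>.\<close>

lemma down_singleton_image_join_covers_iff:
  assumes p: "p \<in> carrier L" and E: "finite E" "E \<subseteq> carrier L"
  shows "(\<lambda>e. down L {e}) ` E \<in> join_covers (ideal_lattice L) (down L {p}) \<longleftrightarrow> E \<in> join_covers L p"
proof -
  let ?A = "\<Union>((\<lambda>e. down L {e}) ` E)"
  have A: "?A = down L E" by (auto simp: down_def)
  have EA: "E \<subseteq> ?A" using E mem_down_singleton by blast
  have "p \<in> ideal_hull L ?A \<longleftrightarrow> (\<exists>u. is_lub L u E \<and> p \<sqsubseteq> u)"
  proof
    assume "\<exists>u. is_lub L u E \<and> p \<sqsubseteq> u"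
    then show "p \<in> ideal_hull L ?A" unfolding ideal_hull_def using p E EA by blast
  next
    assume "p \<in> ideal_hull L ?A"
    then obtain X u where X: "finite X" "X \<subseteq> ?A" "is_lub L u X" "p \<sqsubseteq> u"
      by (auto simp: ideal_hull_def)
    show "\<exists>u. is_lub L u E \<and> p \<sqsubseteq> u"
    proof (cases "E = {}")
      \<comment> \<open>Then \<open>X\<close> is empty too, and its join \<open>u\<close> is also
        the join of \<open>E\<close>.\<close>
      case True
      then show ?thesis using X by auto
    next
      case False
      then obtain w where w: "is_lub L w E" using finite_is_lub[OF E] by blast
      have wE: "w \<in> carrier L" "\<And>e. e \<in> E \<Longrightarrow> e \<sqsubseteq> w" using w E by (auto simp: is_lub_iff)
      have XL: "X \<subseteq> carrier L" using X by (auto simp: down_def)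
      have "x \<sqsubseteq> w" if x: "x \<in> X" for x
      proof -
        obtain e where e: "e \<in> E" "x \<sqsubseteq> e" using X(2) x by (auto simp: down_def)
        moreover have "e \<in> carrier L" "x \<in> carrier L" using e E XL x by auto
        ultimately show ?thesis using le_trans[of x e w] wE XL E x by auto
      qed
      then have "u \<sqsubseteq> w" using X(3) XL wE by (auto simp: is_lub_iff)
      then have "p \<sqsubseteq> w" using le_trans[of p u w] X p wE by simp
      then show ?thesis using w by blast
    qed
  qed
  moreover have "\<forall>I\<in>(\<lambda>e. down L {e}) ` E. sl_ideal L I" using E sl_ideal_down_singleton by blast
  ultimately show ?thesis
    using E unfolding join_covers_down_singleton_iff[OF p] by (auto simp: join_covers_def A)
qed

text \<open>If \<open>e\<close> lay below another member \<open>e'\<close>, it would lie below the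
  join of \<open>E - {e}\<close>, so \<open>E - {e}\<close> would still cover
  \<open>a\<close>.\<close>

lemma minimal_join_cover_antichain:
  assumes E: "E \<in> minimal_join_covers L a" and a: "a \<in> nonzero L"
    and e: "e \<in> E" "e' \<in> E" "e \<sqsubseteq> e'"
  shows "e = e'"
proof (rule ccontr)
  assume ne: "e \<noteq> e'"
  obtain u where u: "finite E" "E \<subseteq> carrier L" "is_lub L u E" "a \<sqsubseteq> u" "a \<in> carrier L"
      "\<forall>e\<in>E. \<not> a \<sqsubseteq> e" "E \<noteq> {}"
    by (rule minimal_join_coverE[OF E a])
  obtain c where c: "is_lub L c (E - {e})" "E - {e} \<noteq> {}" "c \<in> carrier L" "is_lub L (e \<squnion> c) E"
      "a \<sqsubseteq> e \<squnion> c"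
    by (rule minimal_join_cover_decompose[OF E a e(1)])
  have eL: "e \<in> carrier L" "e' \<in> carrier L" using e u by auto
  have sub: "E - {e} \<subseteq> carrier L" using u by auto
  have "e' \<sqsubseteq> c" using c(1) sub e ne by (auto simp: is_lub_iff)
  then have "e \<sqsubseteq> c" using le_trans[of e e' c] e eL c by simp
  then have "e \<squnion> c \<sqsubseteq> c" using join_le[of e c c] eL c by simp
  then have "a \<sqsubseteq> c" using le_trans[of a "e \<squnion> c" c] u eL c by simp
  moreover have "refines L (E - {e}) E" using u by (intro refines_subset) auto
  ultimately have "E \<subseteq> E - {e}"
    using minimal_join_cover_replace[OF E u(5), of "E - {e}"] u sub c by auto
  then show False using e by blast
qed

text \<open>Given a cover \<open>\<X>\<close> refining the image, a finite \<open>X\<close> in its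
  union covers \<open>p\<close> and refines \<open>E\<close>, so \<open>E \<subseteq> X\<close>.
  Hence each \<open>e\<close> in \<open>E\<close> lies in some \<open>J\<close> of
  \<open>\<X>\<close>, and \<open>J \<subseteq> down L {e'}\<close> for some \<open>e'\<close> in
  \<open>E\<close>; since \<open>E\<close> is an antichain, \<open>e = e'\<close> and
  \<open>J\<close> is the principal ideal of \<open>e\<close>.\<close>

lemma down_singleton_image_minimal_join_cover:
  assumes p: "p \<in> nonzero L" and E: "E \<in> minimal_join_covers L p"
  shows "(\<lambda>e. down L {e}) ` E \<in> minimal_join_covers (ideal_lattice L) (down L {p})"
  unfolding minimal_join_covers_def
proof (intro CollectI conjI ballI impI subsetI)
  obtain u where u: "finite E" "E \<subseteq> carrier L" "is_lub L u E" "p \<sqsubseteq> u" "p \<in> carrier L"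
      "\<forall>e\<in>E. \<not> p \<sqsubseteq> e" "E \<noteq> {}"
    by (rule minimal_join_coverE[OF E p])
  show "(\<lambda>e. down L {e}) ` E \<in> join_covers (ideal_lattice L) (down L {p})"
    using E down_singleton_image_join_covers_iff[OF u(5,1,2)] by (simp add: minimal_join_covers_def)
  fix \<X> I
  assume X: "\<X> \<in> join_covers (ideal_lattice L) (down L {p})"
    and ref: "refines (ideal_lattice L) \<X> ((\<lambda>e. down L {e}) ` E)"
    and I: "I \<in> (\<lambda>e. down L {e}) ` E"
  obtain X where X': "X \<in> join_covers L p" "X \<subseteq> \<Union>\<X>" "down L (\<Union>\<X>) \<subseteq> \<Union>\<X>" "\<forall>I\<in>\<X>. sl_ideal L I"
    by (rule join_cover_of_ideal_join_cover[OF u(5) X])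
  have dom: "\<exists>e\<in>E. J \<subseteq> down L {e}" if "J \<in> \<X>" for J
    using ref that by (auto simp: refines_def down_def[of "ideal_lattice L"])
  have "refines L X E"
    unfolding refines_def
  proof
    fix x assume "x \<in> X"
    then obtain J where "J \<in> \<X>" "x \<in> J" using X' by blast
    then show "x \<in> down L E" using dom[of J] by (auto simp: down_def)
  qed
  then have EX: "E \<subseteq> X" using E X' by (auto simp: minimal_join_covers_def)
  obtain e where e: "e \<in> E" "I = down L {e}" using I by blast
  then obtain J where J: "J \<in> \<X>" "e \<in> J" using EX X' by blast
  then obtain e' where e': "e' \<in> E" "J \<subseteq> down L {e'}" using dom by blast
  then have "e \<sqsubseteq> e'" using J by (auto simp: down_def)
  then have "e = e'" using minimal_join_cover_antichain[OF E p] e e' by blast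
  then have "J = I"
    using e e' J X' down_singleton_subset_iff[of e J] u by auto
  then show "I \<in> \<X>" using J by simp
qed

text \<open>Passing to principal ideals preserves refinement and is injective, so minimality can be
  pulled back.\<close>

lemma minimal_join_cover_of_down_singleton_image:
  assumes p: "p \<in> carrier L" and E: "finite E" "E \<subseteq> carrier L"
    and min: "(\<lambda>e. down L {e}) ` E \<in> minimal_join_covers (ideal_lattice L) (down L {p})"
  shows "E \<in> minimal_join_covers L p"
  unfolding minimal_join_covers_def
proof (intro CollectI conjI ballI impI subsetI)
  show "E \<in> join_covers L p"
    using min down_singleton_image_join_covers_iff[OF p E] by (simp add: minimal_join_covers_def)
  fix X e assume X: "X \<in> join_covers L p" "refines L X E" and e: "e \<in> E"
  have XL: "finite X" "X \<subseteq> carrier L" using X by (auto simp: join_covers_def)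
  have "refines (ideal_lattice L) ((\<lambda>e. down L {e}) ` X) ((\<lambda>e. down L {e}) ` E)"
    unfolding refines_def
  proof
    fix J assume "J \<in> (\<lambda>e. down L {e}) ` X"
    then obtain x where x: "x \<in> X" "J = down L {x}" by blast
    then obtain e where e: "e \<in> E" "x \<sqsubseteq> e" using X by (auto simp: refines_def down_def)
    then have "down L {x} \<subseteq> down L {e}"
      using x XL E down_singleton_subset_iff[OF _ sl_ideal_down_singleton, of x e]
      unfolding down_def by blast
    then show "J \<in> down (ideal_lattice L) ((\<lambda>e. down L {e}) ` E)"
      using x e XL sl_ideal_down_singleton[of x] by (auto simp: down_def[of "ideal_lattice L"])
  qed
  then have "(\<lambda>e. down L {e}) ` E \<subseteq> (\<lambda>e. down L {e}) ` X"
    using min X(1) down_singleton_image_join_covers_iff[OF p XL]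
    unfolding minimal_join_covers_def by simp
  then obtain x where "x \<in> X" "down L {e} = down L {x}" using e by blast
  moreover from this have "e = x" using down_singleton_inject[of e x] e E XL by auto
  ultimately show "e \<in> X" by simp
qed

text \<open>The ideal \<open>C\<close> witnessing the dependency has to be replaced by an element.
  Take a finite \<open>X \<subseteq> down L {q} \<union> C\<close> with join above \<open>p\<close>,
  and let \<open>c\<close> be the join of the members of \<open>X\<close> that are not below
  \<open>q\<close>; they lie in \<open>C\<close>, hence so does \<open>c\<close>.\<close>

lemma join_dep_of_ideal_join_dep:
  assumes p: "p \<in> join_irreducibles L" and q: "q \<in> join_irreducibles L"
    and D: "join_dep (ideal_lattice L) (down L {p}) (down L {q})"
  shows "join_dep L p q"
proof -
  have pL: "p \<in> carrier L" and qL: "q \<in> carrier L"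
    using p q by (auto simp: join_irreducibles_def nonzero_def)
  have ne: "down L {p} \<noteq> down L {q}" using D by (simp add: join_dep_def)
  obtain C where "C \<in> carrier (ideal_lattice L)"
    "down L {p} \<sqsubseteq>\<^bsub>ideal_lattice L\<^esub> down L {q} \<squnion>\<^bsub>ideal_lattice L\<^esub> C"
    "\<forall>X\<in>carrier (ideal_lattice L). X \<sqsubset>\<^bsub>ideal_lattice L\<^esub> down L {q} \<longrightarrow>
       \<not> down L {p} \<sqsubseteq>\<^bsub>ideal_lattice L\<^esub> X \<squnion>\<^bsub>ideal_lattice L\<^esub> C"
    using D unfolding join_dep_def by metis
  then have C: "sl_ideal L C" and le: "down L {p} \<subseteq> down L {q} \<squnion>\<^bsub>ideal_lattice L\<^esub> C"
    and nle: "\<And>X. sl_ideal L X \<Longrightarrow> X \<subset> down L {q} \<Longrightarrow> \<not> down L {p} \<subseteq> X \<squnion>\<^bsub>ideal_lattice L\<^esub> C"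
    by simp_all
  have CL: "C \<subseteq> carrier L" using sl_ideal_subset[OF C] .
  have nle': "p \<notin> ideal_hull L (down L {x} \<union> C)" if x: "x \<in> carrier L" "x \<sqsubseteq> q" "x \<noteq> q" for x
  proof
    assume mem: "p \<in> ideal_hull L (down L {x} \<union> C)"
    have "down L {x} \<subseteq> down L {q}"
      using x qL down_singleton_subset_iff[OF x(1) sl_ideal_down_singleton[OF qL]]
      by (auto simp: down_def[of L "{q}"])
    then have "down L {x} \<subset> down L {q}" using down_singleton_inject[OF x(1) qL] x by auto
    moreover have "down L {p} \<subseteq> ideal_hull L (down L {x} \<union> C)"
      using mem pL CL by (subst down_singleton_subset_iff) (auto intro!: sl_ideal_hull simp: down_def)
    ultimately show False
      using nle sl_ideal_down_singleton[OF x(1)] C by (auto simp: join_ideals)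
  qed
  have "p \<in> ideal_hull L (down L {q} \<union> C)"
    using le pL C sl_ideal_down_singleton[OF qL] by (auto simp: join_ideals)
  then obtain X u where X: "finite X" "X \<subseteq> down L {q} \<union> C" "is_lub L u X" "p \<sqsubseteq> u"
    by (auto simp: ideal_hull_def)
  have XL: "X \<subseteq> carrier L" using X CL by (auto simp: down_def)
  have uL: "u \<in> carrier L" using X by simp
  \<comment> \<open>Otherwise \<open>p\<close> would be strictly below \<open>q\<close>, and
    \<open>down L {p}\<close> would be a forbidden replacement for
    \<open>down L {q}\<close>.\<close>
  have "X - down L {q} \<noteq> {}"
  proof
    assume "X - down L {q} = {}"
    then have "u \<sqsubseteq> q" using X(3) XL qL by (auto simp: is_lub_iff down_def)
    then have "p \<sqsubseteq> q" using le_trans[of p u q] X pL qL uL by simp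
    moreover have "p \<in> ideal_hull L (down L {p} \<union> C)"
      using ideal_hull_superset[of "down L {p} \<union> C"] pL CL by (auto simp: down_def)
    ultimately show False using nle'[OF pL] ne by auto
  qed
  then obtain c where c: "is_lub L c (X - down L {q})"
    using finite_is_lub[of "X - down L {q}"] X XL by auto
  have cC: "c \<in> C" by (rule sl_ideal_lub[OF C _ _ c]) (use X in auto)
  then have cL: "c \<in> carrier L" using CL by auto
  have "x \<sqsubseteq> q \<squnion> c" if x: "x \<in> X" for x
  proof (cases "x \<in> down L {q}")
    case True
    then show ?thesis
      using le_trans[of x q "q \<squnion> c"] join_left[of q c] qL cL by (auto simp: down_def)
  next
    case False
    have "X - down L {q} \<subseteq> carrier L" using XL by auto
    then have "x \<sqsubseteq> c" using c x False by (auto simp: is_lub_iff)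
    then show ?thesis using le_trans[of x c "q \<squnion> c"] join_right[of q c] qL cL x XL by auto
  qed
  then have "u \<sqsubseteq> q \<squnion> c" using X(3) XL qL cL by (auto simp: is_lub_iff)
  then have "p \<sqsubseteq> q \<squnion> c" using le_trans[of p u "q \<squnion> c"] X pL qL cL uL by simp
  \<comment> \<open>Since \<open>c \<in> C\<close>, the ideal generated by
    \<open>down L {x} \<union> C\<close> contains \<open>x \<squnion> c\<close> and would therefore
    contain \<open>p\<close>.\<close>
  moreover have "\<not> p \<sqsubseteq> x \<squnion> c" if x: "x \<in> carrier L" "x \<sqsubset> q" for x
  proof
    assume le: "p \<sqsubseteq> x \<squnion> c"
    let ?H = "ideal_hull L (down L {x} \<union> C)"
    have sub: "down L {x} \<union> C \<subseteq> carrier L" using CL by (auto simp: down_def)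
    have "{x, c} \<subseteq> ?H" using ideal_hull_superset[OF sub] x cC by auto
    moreover have "is_lub L (x \<squnion> c) {x, c}"
      unfolding join_def by (rule sup_of_two_least[OF x(1) cL])
    ultimately have "x \<squnion> c \<in> ?H" by (intro sl_ideal_lub[OF sl_ideal_hull[OF sub], of "{x, c}"]) simp_all
    then have "p \<in> ?H" using sl_ideal_mono[OF sl_ideal_hull[OF sub], of "x \<squnion> c" p] pL le by simp
    then show False using nle'[of x] x by (simp add: lless_iff)
  qed
  ultimately show ?thesis using p q ne cL by (auto simp: join_dep_def)
qed

text \<open>A cover of \<open>down L {p}\<close> yields a cover of \<open>p\<close> inside its
  union, refined by a minimal cover \<open>E\<close>. The principal ideals of \<open>E\<close> form
  a minimal cover, and each is contained in a member of the given one.\<close>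

lemma MCRP_on_ideal_lattice:
  assumes M: "MCRP L"
  shows "MCRP_on (ideal_lattice L) ((\<lambda>p. down L {p}) ` join_irreducibles L)"
  unfolding MCRP_on_def
proof (intro ballI conjI)
  let ?d = "\<lambda>p. down L {p}" and ?\<Sigma> = "(\<lambda>p. down L {p}) ` join_irreducibles L"
  fix P assume "P \<in> ?\<Sigma> \<inter> nonzero (ideal_lattice L)"
  then obtain p where p: "p \<in> join_irreducibles L" "P = ?d p" by blast
  then have p0: "p \<in> nonzero L" and pL: "p \<in> carrier L" by (auto simp: join_irreducibles_def nonzero_def)
  show "\<exists>\<E>\<in>minimal_join_covers_in (ideal_lattice L) ?\<Sigma> P. refines (ideal_lattice L) \<E> \<X>"
    if X: "\<X> \<in> join_covers (ideal_lattice L) P" for \<X>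
  proof -
    obtain X where X': "X \<in> join_covers L p" "X \<subseteq> \<Union>\<X>" "down L (\<Union>\<X>) \<subseteq> \<Union>\<X>" "\<forall>I\<in>\<X>. sl_ideal L I"
      using join_cover_of_ideal_join_cover[OF pL] X p by metis
    obtain E where E: "E \<in> minimal_join_covers L p" "refines L E X"
      using MCRP_refine[OF M p0 X'(1)] by metis
    have EJ: "E \<subseteq> join_irreducibles L" using minimal_join_cover_irreducible[OF E(1) p0] .
    have "?d ` E \<in> minimal_join_covers_in (ideal_lattice L) ?\<Sigma> P"
      using down_singleton_image_minimal_join_cover[OF p0 E(1)] EJ p
      by (auto simp: minimal_join_covers_in_def)
    moreover have "refines (ideal_lattice L) (?d ` E) \<X>"
      unfolding refines_def
    proof
      fix I assume "I \<in> ?d ` E"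
      then obtain e where e: "e \<in> E" "I = ?d e" by blast
      then have eL: "e \<in> carrier L" using EJ by (auto simp: join_irreducibles_def nonzero_def)
      have "e \<in> down L X" using e E by (auto simp: refines_def)
      then have "e \<in> down L (\<Union>\<X>)" using X'(2) unfolding down_def by blast
      then have "e \<in> \<Union>\<X>" using X'(3) by blast
      then obtain J where J: "J \<in> \<X>" "e \<in> J" by blast
      then have "I \<subseteq> J" using e eL X' down_singleton_subset_iff by blast
      then show "I \<in> down (ideal_lattice L) \<X>"
        using J e sl_ideal_down_singleton[OF eL] by (auto simp: down_def[of "ideal_lattice L"])
    qed
    ultimately show ?thesis by blast
  qed
  \<comment> \<open>A minimal cover made of principal ideals from \<open>?\<Sigma>\<close> is the
    image of a minimal cover of \<open>p\<close>, and \<open>p\<close> has only finitely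
    many.\<close>
  have "minimal_join_covers_in (ideal_lattice L) ?\<Sigma> P \<subseteq> (\<lambda>E. ?d ` E) ` minimal_join_covers L p"
  proof
    fix \<E> assume \<E>: "\<E> \<in> minimal_join_covers_in (ideal_lattice L) ?\<Sigma> P"
    then have "finite \<E>" "\<E> \<subseteq> ?\<Sigma>"
      by (auto simp: minimal_join_covers_in_def minimal_join_covers_def join_covers_def)
    then obtain E where E: "E \<subseteq> join_irreducibles L" "finite E" "\<E> = ?d ` E"
      by (meson finite_subset_image)
    moreover have "E \<in> minimal_join_covers L p"
      using minimal_join_cover_of_down_singleton_image[OF pL E(2)] E \<E> p
      by (auto simp: minimal_join_covers_in_def join_irreducibles_def nonzero_def)
    ultimately show "\<E> \<in> (\<lambda>E. ?d ` E) ` minimal_join_covers L p" by blast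
  qed
  then show "finite (minimal_join_covers_in (ideal_lattice L) ?\<Sigma> P)"
    using MCRP_finite[OF M p0] finite_subset by blast
qed

text \<open>An element of an ideal is a finite join of join-irreducibles, which belong to the same
  ideal because it is a lower set.\<close>

lemma join_generates_ideal_lattice:
  assumes M: "MCRP L"
  shows "join_generates (ideal_lattice L) ((\<lambda>p. down L {p}) ` join_irreducibles L)"
  unfolding join_generates_def
proof
  fix I assume "I \<in> carrier (ideal_lattice L)"
  then have I: "sl_ideal L I" by simp
  let ?\<X> = "(\<lambda>p. down L {p}) ` (join_irreducibles L \<inter> I)"
  have J: "join_irreducibles L \<subseteq> carrier L" by (auto simp: join_irreducibles_def nonzero_def)
  have idl: "sl_ideal L K" if "K \<in> ?\<X>" for K using that J sl_ideal_down_singleton by blast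
  have "\<Union>?\<X> \<subseteq> I" using down_singleton_subset_iff[OF _ I] J by blast
  then have "ideal_hull L (\<Union>?\<X>) \<subseteq> I" using ideal_hull_subset[OF I] by blast
  moreover have "I \<subseteq> ideal_hull L (\<Union>?\<X>)"
  proof
    fix a assume a: "a \<in> I"
    then have aL: "a \<in> carrier L" using sl_ideal_subset[OF I] by blast
    obtain X where X: "X \<subseteq> join_irreducibles L" "finite X" "is_lub L a X"
      using finite_join_of_irreducibles[OF M aL] by blast
    have "x \<in> I" if "x \<in> X" for x
      using sl_ideal_mono[OF I a, of x] that X J aL is_lub_iff[of X L a] by auto
    then have "X \<subseteq> \<Union>?\<X>" using X J mem_down_singleton by blast
    then show "a \<in> ideal_hull L (\<Union>?\<X>)" unfolding ideal_hull_def using X aL le_refl[of a] by blast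
  qed
  ultimately have "is_lub (ideal_lattice L) I ?\<X>" using is_lub_ideals_iff[OF idl] by auto
  then show "\<exists>X\<subseteq>(\<lambda>p. down L {p}) ` join_irreducibles L. is_lub (ideal_lattice L) I X"
    by (intro exI[of _ ?\<X>] conjI image_mono) auto
qed

theorem fermentable_ideal_lattice:
  assumes M: "MCRP L" and D: "\<not> (\<exists>a. infinite_D_sequence L a)"
  shows "fermentable (ideal_lattice L)"
  unfolding fermentable_def leaven_def
proof (intro exI conjI)
  let ?\<Sigma> = "(\<lambda>p. down L {p}) ` join_irreducibles L"
  show "?\<Sigma> \<subseteq> join_irreducibles (ideal_lattice L)" using down_singleton_irreducible by blast
  show "join_generates (ideal_lattice L) ?\<Sigma>" by (rule join_generates_ideal_lattice[OF M])
  show "MCRP_on (ideal_lattice L) ?\<Sigma>" by (rule MCRP_on_ideal_lattice[OF M])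
  show "\<not> (\<exists>a. infinite_D_sequence (ideal_lattice L) a \<and> range a \<subseteq> ?\<Sigma>)"
  proof
    assume "\<exists>a. infinite_D_sequence (ideal_lattice L) a \<and> range a \<subseteq> ?\<Sigma>"
    then obtain a where a: "infinite_D_sequence (ideal_lattice L) a" "range a \<subseteq> ?\<Sigma>" by blast
    then have "\<forall>n. \<exists>p. p \<in> join_irreducibles L \<and> a n = down L {p}" by blast
    then obtain b where b: "\<And>n. b n \<in> join_irreducibles L \<and> a n = down L {b n}" by metis
    have "infinite_D_sequence L b"
      using a b join_dep_of_ideal_join_dep by (auto simp: infinite_D_sequence_def)
    then show False using D by blast
  qed
qed

end

section \<open>A sufficient condition for lower boundedness\<close>

text \<open>An iterated meet over \<open>G\<close>, which stays in the possibly infinite set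
  \<open>P\<close>. It is the minimum of \<open>P\<close> as soon as lower bounds of
  \<open>G\<close> are known to bound all of \<open>P\<close>.\<close>

lemma (in lower_semilattice) finite_lower_bound_in:
  assumes "finite G" "G \<noteq> {}" "G \<subseteq> P" "P \<subseteq> carrier L"
    and "\<And>x y. x \<in> P \<Longrightarrow> y \<in> P \<Longrightarrow> x \<sqinter> y \<in> P"
  shows "\<exists>l\<in>P. \<forall>g\<in>G. l \<sqsubseteq> g"
  using assms(1-3)
proof (induction G rule: finite_ne_induct)
  case (singleton x)
  then show ?case using assms(4) by blast
next
  case (insert x G)
  then obtain l where l: "l \<in> P" "\<forall>g\<in>G. l \<sqsubseteq> g" by auto
  have cl: "x \<in> carrier L" "l \<in> carrier L" "G \<subseteq> carrier L" "x \<in> P" using l insert assms(4) by auto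
  have "x \<sqinter> l \<sqsubseteq> g" if "g \<in> G" for g
    using le_trans[of "x \<sqinter> l" l g] meet_right[of x l] that l cl by auto
  then show ?case using meet_left[of x l] cl l assms(5) by blast
qed

lemma free_lattice_carrierE:
  assumes "A \<in> carrier (free_lattice X)"
  obtains t where "t \<in> lterms X" "A = lclass X t"
  using assms by (auto simp: carrier_free_lattice)

lemma lclass_closed [simp]: "t \<in> lterms X \<Longrightarrow> lclass X t \<in> carrier (free_lattice X)"
  by (simp add: carrier_free_lattice)

text \<open>
  By well-founded induction, the least element of \<open>{x. a \<in> r (f x)}\<close> is the meet of the generators
  in that set and of the joins \<open>\<Squnion>e\<in>E. m e\<close>, where \<open>E \<in> M a\<close> and \<open>m e\<close> is the least element
  of \<open>{x. e \<in> r (f x)}\<close>.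
\<close>

lemma lower_bounded_latticeI:
  fixes L :: "('b, 'n) gorder_scheme" and r :: "'b \<Rightarrow> 'c set" and M :: "'c \<Rightarrow> 'c set set"
  assumes L: "lattice L"
    and le: "\<And>x y. x \<in> carrier L \<Longrightarrow> y \<in> carrier L \<Longrightarrow> x \<sqsubseteq>\<^bsub>L\<^esub> y \<longleftrightarrow> r x \<subseteq> r y"
    and meet: "\<And>x y. x \<in> carrier L \<Longrightarrow> y \<in> carrier L \<Longrightarrow> r (x \<sqinter>\<^bsub>L\<^esub> y) = r x \<inter> r y"
    and join: "\<And>x y a. x \<in> carrier L \<Longrightarrow> y \<in> carrier L \<Longrightarrow> a \<in> F \<Longrightarrow>
      a \<in> r (x \<squnion>\<^bsub>L\<^esub> y) \<longleftrightarrow> a \<in> r x \<or> a \<in> r y \<or> (\<exists>E\<in>M a. E \<subseteq> r x \<union> r y)"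
    and F: "finite F" "\<And>x. x \<in> carrier L \<Longrightarrow> r x \<subseteq> F"
    and M: "\<And>a. a \<in> F \<Longrightarrow> finite (M a)" "\<And>a E. a \<in> F \<Longrightarrow> E \<in> M a \<Longrightarrow> E \<subseteq> F \<and> E \<noteq> {}"
    and wf: "wf {(b, a). a \<in> F \<and> (\<exists>E\<in>M a. b \<in> E)}"
  shows "lower_bounded_lattice L"
  unfolding lower_bounded_lattice_def
proof (intro conjI allI impI)
  show "lattice L" by fact
  fix X :: "nat set" and f
  assume X: "finite X" and f: "lattice_hom (free_lattice X) L f"
  let ?K = "free_lattice X"
  interpret L: lattice L by fact
  interpret K: lattice ?K by (rule lattice_free_lattice)
  have fK: "f x \<in> carrier L" if "x \<in> carrier ?K" for x
    using f that by (auto simp: lattice_hom_def)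
  have f_join: "f (x \<squnion>\<^bsub>?K\<^esub> y) = f x \<squnion>\<^bsub>L\<^esub> f y" if "x \<in> carrier ?K" "y \<in> carrier ?K" for x y
    using f that by (auto simp: lattice_hom_def join_pres_def)
  have f_meet: "f (x \<sqinter>\<^bsub>?K\<^esub> y) = f x \<sqinter>\<^bsub>L\<^esub> f y" if "x \<in> carrier ?K" "y \<in> carrier ?K" for x y
    using f that by (auto simp: lattice_hom_def meet_pres_def)
  have mono: "r (f x) \<subseteq> r (f y)" if "x \<in> carrier ?K" "y \<in> carrier ?K" "x \<sqsubseteq>\<^bsub>?K\<^esub> y" for x y
  proof -
    have "f x \<squnion>\<^bsub>L\<^esub> f y = f y" using f_join[of x y] K.le_iff_meet[of x y] that by simp
    then have "f x \<sqsubseteq>\<^bsub>L\<^esub> f y" using L.le_iff_meet[of "f x" "f y"] fK that by simp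
    then show ?thesis using le fK that by simp
  qed
  define P where "P a = {x \<in> carrier ?K. a \<in> r (f x)}" for a
  have PK: "P a \<subseteq> carrier ?K" for a by (auto simp: P_def)
  have P_meet: "x \<sqinter>\<^bsub>?K\<^esub> y \<in> P a" if "x \<in> P a" "y \<in> P a" for x y a
    using that f_meet meet fK by (auto simp: P_def)
  have least: "\<exists>m. least ?K m (P a)" if "a \<in> F" "P a \<noteq> {}" for a
    using wf that
  proof (induction a rule: wf_induct_rule)
    case (less a)
    define m where "m e = (SOME m. least ?K m (P e))" for e
    \<comment> \<open>Only covers whose members all have nonempty \<open>P e\<close> can matter; for
      these, \<open>m e\<close> is a genuine minimum by the induction hypothesis.\<close>
    define N where "N = {E \<in> M a. \<forall>e\<in>E. P e \<noteq> {}}"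
    have m: "least ?K (m e) (P e)" if "E \<in> N" "e \<in> E" for E e
    proof -
      have "E \<in> M a" "P e \<noteq> {}" using that by (auto simp: N_def)
      then have "\<exists>m. least ?K m (P e)"
        using less.IH[of e] less.prems M(2)[of a E] that by blast
      then show ?thesis unfolding m_def by (rule someI_ex)
    qed
    have mK: "m ` E \<subseteq> carrier ?K" if "E \<in> N" for E
      using m[OF that] by (auto dest: least_closed)
    have EF: "finite E" "E \<noteq> {}" if "E \<in> N" for E
      using that M(2)[OF less.prems(1), of E] F(1) finite_subset[of E F] by (auto simp: N_def)
    define J where "J E = (SOME u. is_lub ?K u (m ` E))" for E
    have J: "is_lub ?K (J E) (m ` E)" if "E \<in> N" for E
      unfolding J_def
    proof (rule someI_ex, rule K.finite_is_lub)
      show "finite (m ` E)" "m ` E \<noteq> {}" using EF[OF that] by simp_all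
    qed (rule mK[OF that])
    define G where "G = (\<lambda>x. lclass X (LVar x)) ` {x \<in> X. a \<in> r (f (lclass X (LVar x)))} \<union> J ` N"
    have "finite G" using X M(1)[OF less.prems(1)] by (auto simp: G_def N_def)
    have JP: "J E \<in> P a" if E: "E \<in> N" for E
    proof -
      have JK: "J E \<in> carrier ?K" using J[OF E] by simp
      have "e \<in> r (f (J E))" if e: "e \<in> E" for e
      proof -
        have "m e \<in> P e" using m[OF E e] by (rule least_mem)
        moreover have "m e \<sqsubseteq>\<^bsub>?K\<^esub> J E" using J[OF E] mK[OF E] e by (auto simp: is_lub_iff)
        ultimately show ?thesis using mono[of "m e" "J E"] JK by (auto simp: P_def)
      qed
      then have "E \<subseteq> r (f (J E))" by blast
      \<comment> \<open>With both arguments equal to \<open>f (J E)\<close>, the assumption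
        \<open>join\<close> says that \<open>E \<subseteq> r (f (J E))\<close> forces
        \<open>a\<close> into \<open>r (f (J E))\<close>.\<close>
      moreover have "f (J E) \<squnion>\<^bsub>L\<^esub> f (J E) = f (J E)"
        using L.le_iff_meet[of "f (J E)" "f (J E)"] fK[OF JK] by simp
      ultimately have "a \<in> r (f (J E))"
        using join[of "f (J E)" "f (J E)" a] fK[OF JK] less.prems(1) E by (auto simp: N_def)
      then show ?thesis using JK by (simp add: P_def)
    qed
    have GP: "G \<subseteq> P a" using JP by (auto simp: G_def P_def)
    \<comment> \<open>By induction on terms, every lower bound of \<open>G\<close> is below every
      element of \<open>P a\<close>. Nonemptiness of \<open>G\<close> is carried along so that a
      lower bound can be found inside \<open>P a\<close>.\<close>
    have below: "G \<noteq> {} \<and> (\<forall>l\<in>carrier ?K. (\<forall>g\<in>G. l \<sqsubseteq>\<^bsub>?K\<^esub> g) \<longrightarrow> l \<sqsubseteq>\<^bsub>?K\<^esub> lclass X t)"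
      if "t \<in> lterms X" "a \<in> r (f (lclass X t))" for t
      using that
    proof (induction t)
      case (LVar x)
      then have "lclass X (LVar x) \<in> G" by (auto simp: G_def)
      then show ?case by blast
    next
      case (LMeet s t)
      then have st: "lclass X s \<in> carrier ?K" "lclass X t \<in> carrier ?K" by auto
      have "a \<in> r (f (lclass X s))" "a \<in> r (f (lclass X t))"
        using LMeet.prems f_meet[OF st] meet fK st by (auto simp: free_lattice_meet)
      then show ?case
        using LMeet K.meet_le[OF _ _ st] by (auto simp: free_lattice_meet)
    next
      case (LJoin s t)
      then have st: "lclass X s \<in> carrier ?K" "lclass X t \<in> carrier ?K" by auto
      have eq: "lclass X (LJoin s t) = lclass X s \<squnion>\<^bsub>?K\<^esub> lclass X t"
        using LJoin.prems by (simp add: free_lattice_join)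
      let ?j = "lclass X s \<squnion>\<^bsub>?K\<^esub> lclass X t"
      have j: "?j \<in> carrier ?K" "lclass X s \<sqsubseteq>\<^bsub>?K\<^esub> ?j" "lclass X t \<sqsubseteq>\<^bsub>?K\<^esub> ?j"
        using st K.join_left K.join_right by auto
      have up: "l \<sqsubseteq>\<^bsub>?K\<^esub> ?j"
        if "l \<in> carrier ?K" "l \<sqsubseteq>\<^bsub>?K\<^esub> lclass X s \<or> l \<sqsubseteq>\<^bsub>?K\<^esub> lclass X t" for l
        using that j st K.le_trans[of l _ ?j] by blast
      have "a \<in> r (f (lclass X s)) \<or> a \<in> r (f (lclass X t)) \<or>
          (\<exists>E\<in>M a. E \<subseteq> r (f (lclass X s)) \<union> r (f (lclass X t)))"
        using LJoin.prems(2) join[of "f (lclass X s)" "f (lclass X t)" a] fK st less.prems(1)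
        by (simp add: eq f_join)
      then consider "a \<in> r (f (lclass X s))" | "a \<in> r (f (lclass X t))"
        | E where "E \<in> M a" "E \<subseteq> r (f (lclass X s)) \<union> r (f (lclass X t))" by blast
      then show ?case
      proof cases
        case 1
        then have "G \<noteq> {} \<and> (\<forall>l\<in>carrier ?K. (\<forall>g\<in>G. l \<sqsubseteq>\<^bsub>?K\<^esub> g) \<longrightarrow> l \<sqsubseteq>\<^bsub>?K\<^esub> lclass X s)"
          using LJoin by simp
        then show ?thesis unfolding eq using up by simp
      next
        case 2
        then have "G \<noteq> {} \<and> (\<forall>l\<in>carrier ?K. (\<forall>g\<in>G. l \<sqsubseteq>\<^bsub>?K\<^esub> g) \<longrightarrow> l \<sqsubseteq>\<^bsub>?K\<^esub> lclass X t)"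
          using LJoin by simp
        then show ?thesis unfolding eq using up by simp
      next
        \<comment> \<open>Every \<open>e\<close> in \<open>E\<close> already lies in
          \<open>r\<close> of the image of one of the two terms, so \<open>m e\<close> is below that
          term and \<open>J E\<close> is below their join.\<close>
        case 3
        have mem: "lclass X s \<in> P e \<or> lclass X t \<in> P e" if "e \<in> E" for e
          using 3 that st by (auto simp: P_def)
        then have E: "E \<in> N" using 3 by (auto simp: N_def)
        have "m e \<sqsubseteq>\<^bsub>?K\<^esub> ?j" if e: "e \<in> E" for e
        proof (rule up)
          show "m e \<in> carrier ?K" using m[OF E e] by (rule least_closed)
          show "m e \<sqsubseteq>\<^bsub>?K\<^esub> lclass X s \<or> m e \<sqsubseteq>\<^bsub>?K\<^esub> lclass X t"
            using mem[OF e] least_le[OF m[OF E e]] by blast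
        qed
        then have "J E \<sqsubseteq>\<^bsub>?K\<^esub> ?j" using J[OF E] mK[OF E] j by (auto simp: is_lub_iff)
        moreover have JG: "J E \<in> G" using E by (auto simp: G_def)
        moreover have "J E \<in> carrier ?K" using J[OF E] by simp
        ultimately show ?thesis unfolding eq using K.le_trans[of _ "J E" ?j] j(1) by blast
      qed
    qed
    obtain t where "t \<in> lterms X" "a \<in> r (f (lclass X t))"
      using less.prems(2) by (auto simp: P_def elim: free_lattice_carrierE)
    then have "G \<noteq> {}" using below by blast
    then obtain l where l: "l \<in> P a" "\<forall>g\<in>G. l \<sqsubseteq>\<^bsub>?K\<^esub> g"
      using K.finite_lower_bound_in[OF \<open>finite G\<close> _ GP PK P_meet] by blast
    have "l \<sqsubseteq>\<^bsub>?K\<^esub> x" if x: "x \<in> P a" for x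
    proof -
      obtain t where "t \<in> lterms X" "x = lclass X t"
        using x by (auto simp: P_def elim: free_lattice_carrierE)
      then show ?thesis using below[of t] x l PK by (auto simp: P_def)
    qed
    then have "least ?K l (P a)" using l PK by (auto simp: least_def)
    then show ?case by blast
  qed
  show "lower_bounded_hom ?K L f"
    unfolding lower_bounded_hom_def Let_def
  proof (intro conjI ballI f)
    fix b assume b: "b \<in> carrier L"
    let ?P = "{x \<in> carrier ?K. b \<sqsubseteq>\<^bsub>L\<^esub> f x}"
    \<comment> \<open>The preimage of the filter above \<open>b\<close> is the intersection of the
      sets \<open>P a\<close> for \<open>a \<in> r b\<close>; for nonempty \<open>r b\<close> its
      minimum is the join of their minima.\<close>
    have P: "?P = {x \<in> carrier ?K. \<forall>a\<in>r b. x \<in> P a}" using le[OF b] fK by (auto simp: P_def)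
    show "?P = {} \<or> (\<exists>m. least ?K m ?P)"
    proof (cases "?P = {}")
      case False
      then obtain x where x: "x \<in> carrier ?K" "\<And>a. a \<in> r b \<Longrightarrow> x \<in> P a" unfolding P by blast
      have "\<exists>m. least ?K m ?P"
      proof (cases "r b = {}")
        \<comment> \<open>Here the preimage is the whole free lattice, whose least element is a
          lower bound of the finitely many generators; \<open>X\<close> is nonempty because a term
          exists.\<close>
        case True
        then have PK': "?P = carrier ?K" unfolding P by auto
        let ?G = "(\<lambda>x. lclass X (LVar x)) ` X"
        obtain t where "t \<in> lterms X" using x by (auto elim: free_lattice_carrierE)
        then have "X \<noteq> {}" by (induction t) auto
        then obtain l where l: "l \<in> carrier ?K" "\<forall>g\<in>?G. l \<sqsubseteq>\<^bsub>?K\<^esub> g"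
          using K.finite_lower_bound_in[of ?G "carrier ?K"] X by (auto simp: image_subset_iff)
        have "l \<sqsubseteq>\<^bsub>?K\<^esub> lclass X t" if "t \<in> lterms X" for t
          using that
        proof (induction t)
          case (LJoin s t)
          then show ?case
            using K.le_trans[OF _ K.join_left[of "lclass X s" "lclass X t"], of l] l
            by (simp add: free_lattice_join[symmetric])
        next
          case (LMeet s t)
          then show ?case using l by (simp add: free_lattice_meet[symmetric] K.meet_le)
        qed (use l in auto)
        then have "least ?K l (carrier ?K)" using l by (auto simp: least_def elim: free_lattice_carrierE)
        then show ?thesis unfolding PK' by blast
      next
        case False
        have "\<forall>a\<in>r b. \<exists>m. least ?K m (P a)" using least x F(2)[OF b] by blast
        then obtain m where m: "\<And>a. a \<in> r b \<Longrightarrow> least ?K (m a) (P a)" by metis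
        have fin: "finite (m ` r b)" using F b finite_subset by blast
        have mK: "m ` r b \<subseteq> carrier ?K" using least_closed[OF m] by blast
        obtain u where u: "is_lub ?K u (m ` r b)"
          using K.finite_is_lub[OF fin mK] False by auto
        have u': "u \<in> carrier ?K" "\<And>a. a \<in> r b \<Longrightarrow> m a \<sqsubseteq>\<^bsub>?K\<^esub> u"
          "\<And>v. v \<in> carrier ?K \<Longrightarrow> (\<And>a. a \<in> r b \<Longrightarrow> m a \<sqsubseteq>\<^bsub>?K\<^esub> v) \<Longrightarrow> u \<sqsubseteq>\<^bsub>?K\<^esub> v"
          using u mK by (auto simp: is_lub_iff)
        have "u \<in> P a" if a: "a \<in> r b" for a
          using least_mem[OF m[OF a]] mono[OF _ u'(1) u'(2)[OF a]] u'(1) by (auto simp: P_def)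
        then have "least ?K u ?P"
          unfolding P least_def using u' least_le[OF m] by auto
        then show ?thesis by blast
      qed
      then show ?thesis by blast
    qed blast
  qed
qed

section \<open>The covering relation\<close>

text \<open>Well-founded induction: \<open>a\<close> has finitely many immediate predecessors, each
  of which has only finitely many ancestors.\<close>

lemma finite_wf_predecessors:
  assumes "wf R" and "\<And>a. finite {b. (b, a) \<in> R}"
  shows "finite {b. (b, a) \<in> R\<^sup>*}"
  using assms(1)
proof (induction a rule: wf_induct_rule)
  case (less a)
  have "{b. (b, a) \<in> R\<^sup>*} \<subseteq> insert a (\<Union>c\<in>{c. (c, a) \<in> R}. {b. (b, c) \<in> R\<^sup>*})"
    by (auto elim: rtranclE)
  then show ?case using less assms(2) by (auto intro: finite_subset)
qed

text \<open>Pairs are oriented so that well-foundedness excludes sequences in which each term lies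
  in a minimal join-cover of the preceding one.\<close>

definition cover_rel :: "('a, 'm) gorder_scheme \<Rightarrow> ('a \<times> 'a) set" where
  "cover_rel S = {(b, a). a \<in> join_irreducibles S \<and> (\<exists>E\<in>minimal_join_covers S a. b \<in> E)}"

context upper_semilattice
begin

text \<open>Each step of a descending chain is a \<open>join_dep\<close> step, so the chain would be
  an infinite D-sequence.\<close>

lemma wf_cover_rel:
  assumes "\<not> (\<exists>a. infinite_D_sequence L a)"
  shows "wf (cover_rel L)"
  unfolding wf_iff_no_infinite_down_chain
proof
  assume "\<exists>a. \<forall>i. (a (Suc i), a i) \<in> cover_rel L"
  then obtain a where "\<And>i. (a (Suc i), a i) \<in> cover_rel L" by blast
  then have "infinite_D_sequence L a"
    using minimal_join_cover_join_dep by (fastforce simp: infinite_D_sequence_def cover_rel_def)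
  then show False using assms by blast
qed

lemma finite_cover_rel:
  assumes "MCRP L"
  shows "finite {b. (b, a) \<in> cover_rel L}"
proof (cases "a \<in> join_irreducibles L")
  case True
  then have "a \<in> nonzero L" by (simp add: join_irreducibles_def)
  have "{b. (b, a) \<in> cover_rel L} \<subseteq> \<Union>(minimal_join_covers L a)" by (auto simp: cover_rel_def)
  moreover have "finite (\<Union>(minimal_join_covers L a))"
    using MCRP_finite[OF assms \<open>a \<in> nonzero L\<close>]
    by (auto simp: minimal_join_covers_def join_covers_def)
  ultimately show ?thesis by (rule finite_subset)
qed (simp add: cover_rel_def)

end

section \<open>Finite quotients of the ideal lattice\<close>

text \<open>Under the MCRP, this closure makes the trace on \<open>F\<close> of a join of two ideals
  depend only on their traces.\<close>

definition cover_closed :: "('a, 'm) gorder_scheme \<Rightarrow> 'a set \<Rightarrow> bool" where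
  "cover_closed S F \<longleftrightarrow> finite F \<and> F \<subseteq> join_irreducibles S \<and>
     (\<forall>a\<in>F. \<forall>E\<in>minimal_join_covers S a. E \<subseteq> F)"

definition traces :: "('a, 'm) gorder_scheme \<Rightarrow> 'a set \<Rightarrow> 'a set set" where
  "traces S F = (\<lambda>I. I \<inter> F) ` {I. sl_ideal S I}"

text \<open>
  The lattice of the traces \<open>I \<inter> F\<close> is transported to natural numbers, the element type that
  the theorem prescribes for the factors.
\<close>

definition trace_code :: "('a, 'm) gorder_scheme \<Rightarrow> 'a set \<Rightarrow> 'a set \<Rightarrow> nat" where
  "trace_code S F I = to_nat_on (traces S F) (I \<inter> F)"

definition trace_lattice :: "('a, 'm) gorder_scheme \<Rightarrow> 'a set \<Rightarrow> nat gorder" where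
  "trace_lattice S F =
     \<lparr>carrier = trace_code S F ` {I. sl_ideal S I}, eq = (=),
      le = (\<lambda>m n. from_nat_into (traces S F) m \<subseteq> from_nat_into (traces S F) n)\<rparr>"

lemma carrier_trace_lattice: "carrier (trace_lattice S F) = trace_code S F ` {I. sl_ideal S I}"
  by (simp add: trace_lattice_def)

lemma trace_code_closed [simp]: "sl_ideal S I \<Longrightarrow> trace_code S F I \<in> carrier (trace_lattice S F)"
  by (simp add: carrier_trace_lattice)

lemma finite_traces: "finite F \<Longrightarrow> finite (traces S F)"
  by (rule finite_subset[of _ "Pow F"]) (auto simp: traces_def)

lemma from_nat_into_trace_code:
  "finite F \<Longrightarrow> sl_ideal S I \<Longrightarrow> from_nat_into (traces S F) (trace_code S F I) = I \<inter> F"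
  unfolding trace_code_def
  by (rule from_nat_into_to_nat_on) (auto simp: traces_def intro: countable_finite finite_traces[unfolded traces_def])

lemma finite_trace_lattice: "finite F \<Longrightarrow> finite (carrier (trace_lattice S F))"
proof -
  assume "finite F"
  moreover have "carrier (trace_lattice S F) = to_nat_on (traces S F) ` traces S F"
    by (auto simp: carrier_trace_lattice trace_code_def traces_def)
  ultimately show ?thesis using finite_traces[of F S] by simp
qed

lemma trace_code_le_iff:
  "finite F \<Longrightarrow> sl_ideal S I \<Longrightarrow> sl_ideal S J \<Longrightarrow>
     trace_code S F I \<sqsubseteq>\<^bsub>trace_lattice S F\<^esub> trace_code S F J \<longleftrightarrow> I \<inter> F \<subseteq> J \<inter> F"
  by (simp add: trace_lattice_def from_nat_into_trace_code)

lemma trace_code_eq_iff: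
  "finite F \<Longrightarrow> sl_ideal S I \<Longrightarrow> sl_ideal S J \<Longrightarrow>
     trace_code S F I = trace_code S F J \<longleftrightarrow> I \<inter> F = J \<inter> F"
  by (metis from_nat_into_trace_code trace_code_def)

lemma partial_order_trace_lattice: "finite F \<Longrightarrow> partial_order (trace_lattice S F)"
proof
  fix x y assume "finite F" "x \<in> carrier (trace_lattice S F)" "y \<in> carrier (trace_lattice S F)"
    and "x \<sqsubseteq>\<^bsub>trace_lattice S F\<^esub> y" "y \<sqsubseteq>\<^bsub>trace_lattice S F\<^esub> x"
  then have "x = y"
    unfolding carrier_trace_lattice by (auto simp: trace_code_le_iff trace_code_eq_iff)
  then show "x .=\<^bsub>trace_lattice S F\<^esub> y" by (simp add: trace_lattice_def)
qed (auto simp: trace_lattice_def)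

section \<open>The lattice of traces on a cover-closed set\<close>

context upper_semilattice
begin

lemma down_Un: "down S (A \<union> B) = down S A \<union> down S B"
  by (auto simp: down_def)

lemma mem_ideal_hull_Un_iff:
  assumes M: "MCRP L" and a: "a \<in> join_irreducibles L" and I: "sl_ideal L I" and J: "sl_ideal L J"
  shows "a \<in> ideal_hull L (I \<union> J) \<longleftrightarrow>
    a \<in> I \<or> a \<in> J \<or> (\<exists>E\<in>minimal_join_covers L a. E \<subseteq> I \<union> J)"
proof (subst mem_ideal_hull_iff[OF M])
  show "a \<in> nonzero L" using a by (simp add: join_irreducibles_def)
  show "I \<union> J \<subseteq> carrier L" "down L (I \<union> J) \<subseteq> I \<union> J"
    using sl_ideal_subset[OF I] sl_ideal_subset[OF J] sl_ideal_down[OF I] sl_ideal_down[OF J]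
    by (auto simp: down_Un)
qed auto

context
  fixes F
  assumes M: "MCRP L" and F: "cover_closed L F"
begin

lemma finite_of_cover_closed: "finite F"
  using F by (simp add: cover_closed_def)

text \<open>Let the trace of \<open>K\<close> contain those of \<open>I\<close> and
  \<open>J\<close>. An element of \<open>F\<close> in the join lies in \<open>I \<union> J\<close>
  or has a minimal cover there; the cover is contained in \<open>F\<close>, hence in
  \<open>K\<close>, which therefore contains the element.\<close>

lemma is_lub_trace_code:
  assumes I: "sl_ideal L I" and J: "sl_ideal L J"
  shows "is_lub (trace_lattice L F) (trace_code L F (ideal_hull L (I \<union> J)))
    {trace_code L F I, trace_code L F J}"
proof -
  have sub: "I \<union> J \<subseteq> carrier L" using I J by (auto simp: sl_ideal_def)
  note H = sl_ideal_hull[OF sub]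
  have "ideal_hull L (I \<union> J) \<inter> F \<subseteq> K \<inter> F"
    if K: "sl_ideal L K" "I \<inter> F \<subseteq> K \<inter> F" "J \<inter> F \<subseteq> K \<inter> F" for K
  proof
    fix a assume a: "a \<in> ideal_hull L (I \<union> J) \<inter> F"
    then have aJ: "a \<in> join_irreducibles L" using F by (auto simp: cover_closed_def)
    consider "a \<in> I \<union> J" | E where "E \<in> minimal_join_covers L a" "E \<subseteq> I \<union> J"
      using a mem_ideal_hull_Un_iff[OF M aJ I J] by auto
    then have "a \<in> K"
    proof cases
      case 1
      then show ?thesis using K a by auto
    next
      case 2
      then have "E \<subseteq> F" using F a unfolding cover_closed_def by blast
      then have "E \<subseteq> K" using 2 K by auto
      \<comment> \<open>Taking \<open>K\<close> twice lets the criterion for two ideals apply to a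
        single one.\<close>
      then have "a \<in> ideal_hull L (K \<union> K)" using mem_ideal_hull_Un_iff[OF M aJ K(1) K(1)] 2 by auto
      then show ?thesis using ideal_hull_subset[OF K(1), of "K \<union> K"] by auto
    qed
    then show "a \<in> K \<inter> F" using a by simp
  qed
  moreover have "I \<inter> F \<subseteq> ideal_hull L (I \<union> J) \<inter> F" "J \<inter> F \<subseteq> ideal_hull L (I \<union> J) \<inter> F"
    using ideal_hull_superset[OF sub] by auto
  ultimately show ?thesis
    using I J H finite_of_cover_closed
    by (subst is_lub_iff) (auto simp: carrier_trace_lattice trace_code_le_iff simp del: Int_subset_iff)
qed

lemma is_glb_trace_code:
  assumes I: "sl_ideal L I" and J: "sl_ideal L J"
  shows "is_glb (trace_lattice L F) (trace_code L F (I \<inter> J)) {trace_code L F I, trace_code L F J}"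
  using I J sl_ideal_Int[OF I J] finite_of_cover_closed
  by (subst is_glb_iff) (auto simp: carrier_trace_lattice trace_code_le_iff)

lemma lattice_trace_lattice: "lattice (trace_lattice L F)"
proof -
  interpret T: partial_order "trace_lattice L F" by (rule partial_order_trace_lattice[OF finite_of_cover_closed])
  show ?thesis
    by standard (auto simp: carrier_trace_lattice intro: is_lub_trace_code is_glb_trace_code)
qed

lemma trace_code_join:
  "sl_ideal L I \<Longrightarrow> sl_ideal L J \<Longrightarrow>
    trace_code L F I \<squnion>\<^bsub>trace_lattice L F\<^esub> trace_code L F J = trace_code L F (ideal_hull L (I \<union> J))"
  by (rule partial_order.join_eqI[OF partial_order_trace_lattice[OF finite_of_cover_closed] is_lub_trace_code])

lemma trace_code_meet:
  "sl_ideal L I \<Longrightarrow> sl_ideal L J \<Longrightarrow>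
    trace_code L F I \<sqinter>\<^bsub>trace_lattice L F\<^esub> trace_code L F J = trace_code L F (I \<inter> J)"
  by (rule partial_order.meet_eqI[OF partial_order_trace_lattice[OF finite_of_cover_closed] is_glb_trace_code])

text \<open>The sufficient condition is applied with \<open>r\<close> decoding a number into its
  trace and with the minimal join-covers in \<open>L\<close> as covers of the elements of
  \<open>F\<close>.\<close>

lemma lower_bounded_trace_lattice:
  assumes D: "\<not> (\<exists>a. infinite_D_sequence L a)"
  shows "lower_bounded_lattice (trace_lattice L F)"
proof (rule lower_bounded_latticeI[where r = "from_nat_into (traces L F)" and F = F
      and M = "minimal_join_covers L"])
  let ?r = "from_nat_into (traces L F)"
  show "lattice (trace_lattice L F)" by (rule lattice_trace_lattice)
  show "finite F" by (rule finite_of_cover_closed)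
  have F0: "a \<in> nonzero L" if "a \<in> F" for a
    using that F by (auto simp: cover_closed_def join_irreducibles_def)
  show "finite (minimal_join_covers L a)" if "a \<in> F" for a by (rule MCRP_finite[OF M F0[OF that]])
  show "E \<subseteq> F \<and> E \<noteq> {}" if "a \<in> F" "E \<in> minimal_join_covers L a" for a E
    using that F minimal_join_coverE[OF that(2) F0[OF that(1)]] by (auto simp: cover_closed_def)
  show "wf {(b, a). a \<in> F \<and> (\<exists>E\<in>minimal_join_covers L a. b \<in> E)}"
    by (rule wf_subset[OF wf_cover_rel[OF D]]) (use F in \<open>auto simp: cover_rel_def cover_closed_def\<close>)
  fix x assume "x \<in> carrier (trace_lattice L F)"
  then obtain I where I: "sl_ideal L I" "x = trace_code L F I" by (auto simp: carrier_trace_lattice)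
  show "?r x \<subseteq> F" using I finite_of_cover_closed by (simp add: from_nat_into_trace_code)
  fix y assume "y \<in> carrier (trace_lattice L F)"
  then obtain J where J: "sl_ideal L J" "y = trace_code L F J" by (auto simp: carrier_trace_lattice)
  show "x \<sqsubseteq>\<^bsub>trace_lattice L F\<^esub> y \<longleftrightarrow> ?r x \<subseteq> ?r y" by (simp add: trace_lattice_def)
  show "?r (x \<sqinter>\<^bsub>trace_lattice L F\<^esub> y) = ?r x \<inter> ?r y"
    using I J finite_of_cover_closed by (auto simp: trace_code_meet from_nat_into_trace_code sl_ideal_Int)
  have sub: "I \<union> J \<subseteq> carrier L" using I J by (auto simp: sl_ideal_def)
  show "a \<in> ?r (x \<squnion>\<^bsub>trace_lattice L F\<^esub> y) \<longleftrightarrow>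
      a \<in> ?r x \<or> a \<in> ?r y \<or> (\<exists>E\<in>minimal_join_covers L a. E \<subseteq> ?r x \<union> ?r y)" if a: "a \<in> F" for a
  proof -
    have aJ: "a \<in> join_irreducibles L" and "\<And>E. E \<in> minimal_join_covers L a \<Longrightarrow> E \<subseteq> F"
      using F a by (auto simp: cover_closed_def)
    \<comment> \<open>Minimal covers of elements of \<open>F\<close> lie in \<open>F\<close>, so
      comparing them with ideals or with traces is the same.\<close>
    then have "(\<exists>E\<in>minimal_join_covers L a. E \<subseteq> I \<inter> F \<union> J \<inter> F) \<longleftrightarrow>
        (\<exists>E\<in>minimal_join_covers L a. E \<subseteq> I \<union> J)"
      by (intro bex_cong) auto
    then show ?thesis
      using I J finite_of_cover_closed a mem_ideal_hull_Un_iff[OF M aJ I(1) J(1)] sl_ideal_hull[OF sub]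
      by (simp add: trace_code_join from_nat_into_trace_code)
  qed
qed

end

end

section \<open>Direct products\<close>

lemma carrier_direct_product: "carrier (direct_product I L) = (\<Pi>\<^sub>E i\<in>I. carrier (L i))"
  and le_direct_product: "f \<sqsubseteq>\<^bsub>direct_product I L\<^esub> g \<longleftrightarrow> (\<forall>i\<in>I. f i \<sqsubseteq>\<^bsub>L i\<^esub> g i)"
  by (simp_all add: direct_product_def)

context
  fixes I :: "'i set" and L :: "'i \<Rightarrow> ('b, 'n) gorder_scheme"
  assumes L: "\<And>i. i \<in> I \<Longrightarrow> lattice (L i)"
begin

lemma partial_order_direct_product: "partial_order (direct_product I L)"
proof
  have po: "partial_order (L i)" if "i \<in> I" for i
    using L[OF that] by (rule lattice.axioms(1)[THEN upper_semilattice.axioms(1)])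
  note wpo = partial_order.axioms(1)[OF po]
  fix f g
  assume f: "f \<in> carrier (direct_product I L)" and g: "g \<in> carrier (direct_product I L)"
  {
    assume "f \<sqsubseteq>\<^bsub>direct_product I L\<^esub> g" "g \<sqsubseteq>\<^bsub>direct_product I L\<^esub> f"
    then have "f i = g i" if "i \<in> I" for i
      using that f g partial_order.le_antisym[OF po[OF that], of "f i" "g i"]
      by (auto simp: carrier_direct_product le_direct_product PiE_iff)
    then have "f = g" using f g by (auto simp: carrier_direct_product intro: PiE_ext)
    then show "f .=\<^bsub>direct_product I L\<^esub> g" by (simp add: direct_product_def)
  }
  fix h assume h: "h \<in> carrier (direct_product I L)"
  assume *: "f \<sqsubseteq>\<^bsub>direct_product I L\<^esub> g" "g \<sqsubseteq>\<^bsub>direct_product I L\<^esub> h"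
  have "f i \<sqsubseteq>\<^bsub>L i\<^esub> h i" if "i \<in> I" for i
    using weak_partial_order.le_trans[OF wpo[OF that], of "f i" "g i" "h i"] * f g h that
    by (auto simp: carrier_direct_product le_direct_product PiE_iff)
  then show "f \<sqsubseteq>\<^bsub>direct_product I L\<^esub> h" by (simp add: le_direct_product)
next
  fix f assume "f \<in> carrier (direct_product I L)"
  then have "f i \<sqsubseteq>\<^bsub>L i\<^esub> f i" if "i \<in> I" for i
    using weak_partial_order.le_refl[of "L i" "f i"] that
      L[OF that, THEN lattice.axioms(1), THEN upper_semilattice.axioms(1), THEN partial_order.axioms(1)]
    by (auto simp: carrier_direct_product)
  then show "f \<sqsubseteq>\<^bsub>direct_product I L\<^esub> f" by (simp add: le_direct_product)
qed (simp_all add: direct_product_def)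

lemma is_lub_direct_product:
  assumes fg: "f \<in> carrier (direct_product I L)" "g \<in> carrier (direct_product I L)"
  shows "is_lub (direct_product I L) (\<lambda>i\<in>I. f i \<squnion>\<^bsub>L i\<^esub> g i) {f, g}"
proof -
  have "is_lub (L i) (f i \<squnion>\<^bsub>L i\<^esub> g i) {f i, g i}" if i: "i \<in> I" for i
  proof -
    interpret lattice "L i" by (rule L[OF i])
    show ?thesis
      using sup_of_two_least[of "f i" "g i"] fg i by (auto simp: join_def carrier_direct_product)
  qed
  then show ?thesis
    using fg by (auto simp: is_lub_iff carrier_direct_product le_direct_product PiE_iff)
qed

lemma is_glb_direct_product:
  assumes fg: "f \<in> carrier (direct_product I L)" "g \<in> carrier (direct_product I L)"
  shows "is_glb (direct_product I L) (\<lambda>i\<in>I. f i \<sqinter>\<^bsub>L i\<^esub> g i) {f, g}"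
proof -
  have "is_glb (L i) (f i \<sqinter>\<^bsub>L i\<^esub> g i) {f i, g i}" if i: "i \<in> I" for i
  proof -
    interpret lattice "L i" by (rule L[OF i])
    show ?thesis
      using inf_of_two_greatest[of "f i" "g i"] fg i by (auto simp: meet_def carrier_direct_product)
  qed
  then show ?thesis
    using fg by (auto simp: is_glb_iff carrier_direct_product le_direct_product PiE_iff)
qed

lemma lattice_direct_product: "lattice (direct_product I L)"
proof -
  interpret partial_order "direct_product I L" by (rule partial_order_direct_product)
  show ?thesis by standard (blast intro: is_lub_direct_product is_glb_direct_product)+
qed

lemma join_direct_product:
  "f \<in> carrier (direct_product I L) \<Longrightarrow> g \<in> carrier (direct_product I L) \<Longrightarrow>
    f \<squnion>\<^bsub>direct_product I L\<^esub> g = (\<lambda>i\<in>I. f i \<squnion>\<^bsub>L i\<^esub> g i)"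
  by (rule partial_order.join_eqI[OF partial_order_direct_product is_lub_direct_product])

lemma meet_direct_product:
  "f \<in> carrier (direct_product I L) \<Longrightarrow> g \<in> carrier (direct_product I L) \<Longrightarrow>
    f \<sqinter>\<^bsub>direct_product I L\<^esub> g = (\<lambda>i\<in>I. f i \<sqinter>\<^bsub>L i\<^esub> g i)"
  by (rule partial_order.meet_eqI[OF partial_order_direct_product is_glb_direct_product])

end

text \<open>The universal property of the product: joins and meets there are coordinatewise, so a
  family of homomorphisms combines into one.\<close>

lemma lattice_hom_into_direct_product:
  assumes K: "lattice K" and L: "\<And>i. i \<in> I \<Longrightarrow> lattice (L i)"
    and f: "\<And>i. i \<in> I \<Longrightarrow> lattice_hom K (L i) (f i)"
  shows "lattice_hom K (direct_product I L) (\<lambda>x. \<lambda>i\<in>I. f i x)"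
proof -
  interpret K: lattice K by fact
  have cl: "(\<lambda>i\<in>I. f i x) \<in> carrier (direct_product I L)" if "x \<in> carrier K" for x
    using f that by (auto simp: carrier_direct_product lattice_hom_def)
  moreover have "(\<lambda>i\<in>I. f i (x \<squnion>\<^bsub>K\<^esub> y)) = (\<lambda>i\<in>I. f i x) \<squnion>\<^bsub>direct_product I L\<^esub> (\<lambda>i\<in>I. f i y)"
      "(\<lambda>i\<in>I. f i (x \<sqinter>\<^bsub>K\<^esub> y)) = (\<lambda>i\<in>I. f i x) \<sqinter>\<^bsub>direct_product I L\<^esub> (\<lambda>i\<in>I. f i y)"
    if "x \<in> carrier K" "y \<in> carrier K" for x y
    using that f unfolding join_direct_product[OF L cl[OF that(1)] cl[OF that(2)], simplified]
      meet_direct_product[OF L cl[OF that(1)] cl[OF that(2)], simplified]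
    by (auto simp: lattice_hom_def join_pres_def meet_pres_def intro!: restrict_ext)
  ultimately show ?thesis
    using K lattice_direct_product[of I L, OF L]
    unfolding lattice_hom_def join_pres_def meet_pres_def by auto
qed

section \<open>Separation of ideals by finite traces\<close>

context upper_semilattice
begin

lemma lattice_hom_trace_code:
  assumes "MCRP L" "cover_closed L F"
  shows "lattice_hom (ideal_lattice L) (trace_lattice L F) (trace_code L F)"
  using lattice_trace_lattice[OF assms] lattice_ideal_lattice
  by (auto simp: lattice_hom_def join_pres_def meet_pres_def trace_code_join[OF assms]
      trace_code_meet[OF assms] join_ideals meet_ideals)

text \<open>Take everything reachable from \<open>p\<close> by passing repeatedly to members of
  minimal join-covers. It is finite because \<open>cover_rel\<close> is well-founded and every
  element has finitely many immediate predecessors.\<close>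

lemma cover_closed_exists:
  assumes M: "MCRP L" and D: "\<not> (\<exists>a. infinite_D_sequence L a)" and p: "p \<in> join_irreducibles L"
  shows "\<exists>F. p \<in> F \<and> cover_closed L F"
proof (intro exI conjI)
  let ?F = "{b. (b, p) \<in> (cover_rel L)\<^sup>*}"
  show "p \<in> ?F" by simp
  have J: "E \<subseteq> join_irreducibles L" if "a \<in> join_irreducibles L" "E \<in> minimal_join_covers L a" for a E
    using minimal_join_cover_irreducible[OF that(2)] that(1) by (simp add: join_irreducibles_def)
  \<comment> \<open>Either \<open>b\<close> is \<open>p\<close>, or the first step of the chain
    places \<open>b\<close> in a minimal join-cover of a join-irreducible.\<close>
  have sub: "b \<in> join_irreducibles L" if "(b, p) \<in> (cover_rel L)\<^sup>*" for b
    using that by (cases rule: converse_rtranclE) (use p J in \<open>auto simp: cover_rel_def\<close>)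
  have "(b, p) \<in> (cover_rel L)\<^sup>*"
    if "(a, p) \<in> (cover_rel L)\<^sup>*" "E \<in> minimal_join_covers L a" "b \<in> E" for a b E
  proof -
    have "(b, a) \<in> cover_rel L" using that sub by (auto simp: cover_rel_def)
    then show ?thesis using that(1) by (rule converse_rtrancl_into_rtrancl)
  qed
  then show "cover_closed L ?F"
    unfolding cover_closed_def
    using sub finite_wf_predecessors[OF wf_cover_rel[OF D] finite_cover_rel[OF M], of p] by auto
qed

text \<open>Each element of an ideal is a finite join of join-irreducibles below it, and these lie
  in the ideal as well.\<close>

lemma ideal_eqI:
  assumes M: "MCRP L" and I: "sl_ideal L I" and J: "sl_ideal L J"
    and eq: "I \<inter> join_irreducibles L = J \<inter> join_irreducibles L"
  shows "I = J"
proof -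
  have "I \<subseteq> J" if I: "sl_ideal L I" and J: "sl_ideal L J"
    and eq: "I \<inter> join_irreducibles L \<subseteq> J" for I J
  proof
    fix a assume a: "a \<in> I"
    then have aL: "a \<in> carrier L" using sl_ideal_subset[OF I] by blast
    obtain X where X: "X \<subseteq> join_irreducibles L" "finite X" "is_lub L a X"
      using finite_join_of_irreducibles[OF M aL] by blast
    then have XL: "X \<subseteq> carrier L" by (auto simp: join_irreducibles_def nonzero_def)
    have "x \<in> I" if "x \<in> X" for x
      using sl_ideal_mono[OF I a, of x] that X XL is_lub_iff[OF XL, of a] by auto
    then have "X \<subseteq> J" using X eq by auto
    then show "a \<in> J" using sl_ideal_lub[OF J] X by blast
  qed
  from this[OF I J] this[OF J I] show ?thesis using eq by auto
qed

text \<open>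
  The second component of an index is a dummy; it only gives the indices the type of pairs.
\<close>

theorem ideal_lattice_embedding:
  assumes M: "MCRP L" and D: "\<not> (\<exists>a. infinite_D_sequence L a)"
  shows "lattice_embedding (ideal_lattice L)
    (direct_product (Collect (cover_closed L) \<times> {{}}) (\<lambda>i. trace_lattice L (fst i)))
    (\<lambda>K. \<lambda>i\<in>Collect (cover_closed L) \<times> {{}}. trace_code L (fst i) K)"
  unfolding lattice_embedding_def
proof
  let ?I = "Collect (cover_closed L) \<times> {{}}"
  show "lattice_hom (ideal_lattice L) (direct_product ?I (\<lambda>i. trace_lattice L (fst i)))
      (\<lambda>K. \<lambda>i\<in>?I. trace_code L (fst i) K)"
    by (rule lattice_hom_into_direct_product)
      (auto intro: lattice_ideal_lattice lattice_trace_lattice[OF M] lattice_hom_trace_code[OF M])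
  show "inj_on (\<lambda>K. \<lambda>i\<in>?I. trace_code L (fst i) K) (carrier (ideal_lattice L))"
  proof (rule inj_onI)
    fix A B assume "A \<in> carrier (ideal_lattice L)" "B \<in> carrier (ideal_lattice L)"
    then have AB: "sl_ideal L A" "sl_ideal L B" by auto
    assume eq: "(\<lambda>i\<in>?I. trace_code L (fst i) A) = (\<lambda>i\<in>?I. trace_code L (fst i) B)"
    have F: "A \<inter> F = B \<inter> F" if "cover_closed L F" for F
    proof -
      have "trace_code L F A = trace_code L F B" using fun_cong[OF eq, of "(F, {})"] that by simp
      moreover have "finite F" using that by (simp add: cover_closed_def)
      ultimately show ?thesis using trace_code_eq_iff AB by metis
    qed
    \<comment> \<open>Every join-irreducible belongs to some finite cover-closed set, whose trace
      detects it.\<close>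
    have "p \<in> A \<longleftrightarrow> p \<in> B" if "p \<in> join_irreducibles L" for p
      using cover_closed_exists[OF M D that] F by blast
    then show "A = B" using ideal_eqI[OF M AB] by blast
  qed
qed

end

theorem corollary5p4:
  fixes S :: "('a, 'm) gorder_scheme"
  assumes "upper_semilattice S"
    and "MCRP S"
    and "\<not> (\<exists>a. infinite_D_sequence S a)"
  shows "fermentable (ideal_lattice S) \<and>
    (\<exists>(I :: ('a set \<times> 'a set) set) (L :: 'a set \<times> 'a set \<Rightarrow> nat gorder) \<phi>.
       (\<forall>i\<in>I. finite (carrier (L i)) \<and> lower_bounded_lattice (L i)) \<and>
       lattice_embedding (ideal_lattice S) (direct_product I L) \<phi>)"
proof -
  interpret upper_semilattice S by fact
  have "finite (carrier (trace_lattice S (fst i))) \<and> lower_bounded_lattice (trace_lattice S (fst i))"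
    if "i \<in> Collect (cover_closed S) \<times> {{}}" for i :: "'a set \<times> 'a set"
  proof -
    have F: "cover_closed S (fst i)" using that by auto
    then have "finite (fst i)" by (simp add: cover_closed_def)
    then show ?thesis
      using lower_bounded_trace_lattice[OF assms(2) F assms(3)] finite_trace_lattice by simp
  qed
  then show ?thesis
    by (intro conjI fermentable_ideal_lattice assms exI, intro ballI)
      (assumption | rule ideal_lattice_embedding assms)+
qed

end
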